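(* The Farey-Stern-Brocot AF $C^*$-algebra $\mathfrak M_1$ is residually finite-dimensional; that is, for every nonzero $a\in\mathfrak M_1$ there is a finite-dimensional representation $\pi$ of $\mathfrak M_1$ with $\pi(a)\neq 0$.
   Context: A unital AF $C^*$-algebra is the norm closure of an ascending sequence of finite-dimensional $C^*$-algebras, all with the same unit. For a unital AF algebra $\mathfrak U$, $K_0(\mathfrak U)$ denotes the Grothendieck group $K_0$ with its natural partial order and with the class of the unit of $\mathfrak U$ as distinguished order unit; by Elliott's classification it determines $\mathfrak U$ up to isomorphism among unital AF algebras. $(M_1,1)$ is the unital lattice-ordered abelian group (pointwise operations) of all continuous piecewise (affine) linear functions $f\colon[0,1]\to\mathbb R$ (finitely many pieces) where each piece is a linear polynomial with integer coefficients, with the constant function $1$ as distinguished unit. $\mathfrak M_1$ is the unital AF $C^*$-algebra defined (up to isomorphism) by $K_0(\mathfrak M_1)=(M_1,1)$. *)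

theory Defs
  imports "HOL-Analysis.Analysis" "HOL-Algebra.Group" "Jordan_Normal_Form.Schur_Decomposition"
begin

section \<open>Unital \<open>C\<^sup>*\<close>-algebras\<close>

text \<open>
  The real Banach algebra structure is the library's; complex scalars and the involution are added
  on top, the complex scalar multiplication extending \<open>scaleR\<close>.  The inherited axiom
  \<open>norm 1 = 1\<close> excludes only the zero algebra.
\<close>

class unital_cstar_algebra = real_normed_algebra_1 + banach +
  fixes scaleC :: "complex \<Rightarrow> 'a \<Rightarrow> 'a" (infixr \<open>*\<^sub>C\<close> 75)
    and star :: "'a \<Rightarrow> 'a"
  assumes scaleC_add_right: "c *\<^sub>C (a + b) = c *\<^sub>C a + c *\<^sub>C b"
    and scaleC_add_left: "(c + d) *\<^sub>C a = c *\<^sub>C a + d *\<^sub>C a"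
    and scaleC_scaleC: "c *\<^sub>C d *\<^sub>C a = (c * d) *\<^sub>C a"
    and scaleC_of_real: "complex_of_real r *\<^sub>C a = r *\<^sub>R a"
    and scaleC_mult_left: "(c *\<^sub>C a) * b = c *\<^sub>C (a * b)"
    and scaleC_mult_right: "a * (c *\<^sub>C b) = c *\<^sub>C (a * b)"
    and norm_scaleC: "norm (c *\<^sub>C a) = cmod c * norm a"
    and star_add: "star (a + b) = star a + star b"
    and star_scaleC: "star (c *\<^sub>C a) = cnj c *\<^sub>C star a"
    and star_mult: "star (a * b) = star b * star a"
    and star_star: "star (star a) = a"
    and cstar_identity: "norm (star a * a) = (norm a)\<^sup>2"

instantiation complex :: unital_cstar_algebra
begin

definition scaleC_complex :: "complex \<Rightarrow> complex \<Rightarrow> complex" where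
  "scaleC_complex c a = c * a"

definition star_complex :: "complex \<Rightarrow> complex" where
  "star_complex a = cnj a"

instance
  by standard
    (auto simp: scaleC_complex_def star_complex_def algebra_simps scaleR_conv_of_real
      norm_mult power2_eq_square)

end

global_interpretation complex_vector:
  vector_space "scaleC :: complex \<Rightarrow> 'a \<Rightarrow> 'a::unital_cstar_algebra"
proof
  fix a :: 'a
  show "1 *\<^sub>C a = a"
    using scaleC_of_real[of 1 a] by simp
qed (simp_all add: scaleC_add_right scaleC_add_left scaleC_scaleC)

section \<open>Unital AF algebras\<close>

text \<open>Closedness is not required below, since finite-dimensional subspaces are closed.\<close>

definition fd_unital_star_subalgebra :: "'a::unital_cstar_algebra set \<Rightarrow> bool" where
  "fd_unital_star_subalgebra B \<longleftrightarrow>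
     complex_vector.subspace B \<and> 1 \<in> B \<and>
     (\<forall>a\<in>B. \<forall>b\<in>B. a * b \<in> B) \<and> (\<forall>a\<in>B. star a \<in> B) \<and>
     (\<exists>S. finite S \<and> B = complex_vector.span S)"

definition unital_AF_algebra :: "'a::unital_cstar_algebra itself \<Rightarrow> bool" where
  "unital_AF_algebra _ \<longleftrightarrow>
     (\<exists>B :: nat \<Rightarrow> 'a set. (\<forall>n. fd_unital_star_subalgebra (B n)) \<and>
        (\<forall>n. B n \<subseteq> B (Suc n)) \<and> closure (\<Union>n. B n) = UNIV)"

section \<open>Partially ordered abelian groups with a distinguished unit\<close>

record 'g unital_po_group = "'g monoid" +
  leq :: "'g \<Rightarrow> 'g \<Rightarrow> bool"
  ounit :: 'g

definition unital_po_group_iso ::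
  "'g unital_po_group \<Rightarrow> 'h unital_po_group \<Rightarrow> ('g \<Rightarrow> 'h) set" where
  "unital_po_group_iso G H =
     {\<phi> \<in> iso G H. (\<forall>x\<in>carrier G. \<forall>y\<in>carrier G. leq G x y \<longleftrightarrow> leq H (\<phi> x) (\<phi> y)) \<and>
        \<phi> (ounit G) = ounit H}"

section \<open>The unital ordered group \<open>K\<^sub>0\<close>\<close>

definition mat_star :: "'a::unital_cstar_algebra mat \<Rightarrow> 'a mat" where
  "mat_star A = map_mat star (transpose_mat A)"

text \<open>Projections in all matrix algebras over \<open>'a\<close>, of arbitrary finite size.\<close>

definition projections :: "'a::unital_cstar_algebra mat set" where
  "projections = {p. square_mat p \<and> p * p = p \<and> mat_star p = p}"

text \<open>
  Murray--von Neumann equivalence; the implementing matrix may be rectangular, so that projections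
  of different sizes are compared directly.
\<close>

definition mvn_equiv :: "'a::unital_cstar_algebra mat \<Rightarrow> 'a mat \<Rightarrow> bool" where
  "mvn_equiv p q \<longleftrightarrow>
     (\<exists>v \<in> carrier_mat (dim_row q) (dim_row p). p = mat_star v * v \<and> q = v * mat_star v)"

definition dsum :: "'a::zero mat \<Rightarrow> 'a mat \<Rightarrow> 'a mat" (infixr \<open>\<oplus>\<^sub>m\<close> 65) where
  "p \<oplus>\<^sub>m q = four_block_mat p (0\<^sub>m (dim_row p) (dim_col q)) (0\<^sub>m (dim_row q) (dim_col p)) q"

text \<open>
  The Grothendieck group of the monoid of equivalence classes of projections under
  \<open>\<oplus>\<^sub>m\<close>: the pair \<open>(p, q)\<close> stands for the formal difference \<open>[p] - [q]\<close>.
\<close>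

definition K0_rel ::
  "(('a::unital_cstar_algebra mat \<times> 'a mat) \<times> ('a mat \<times> 'a mat)) set" where
  "K0_rel = {((p, q), (p', q')).
     p \<in> projections \<and> q \<in> projections \<and> p' \<in> projections \<and> q' \<in> projections \<and>
     (\<exists>r\<in>projections. mvn_equiv (p \<oplus>\<^sub>m q' \<oplus>\<^sub>m r) (p' \<oplus>\<^sub>m q \<oplus>\<^sub>m r))}"

definition K0_diff ::
  "'a::unital_cstar_algebra mat \<Rightarrow> 'a mat \<Rightarrow> ('a mat \<times> 'a mat) set" where
  "K0_diff p q = K0_rel `` {(p, q)}"

abbreviation K0_class :: "'a::unital_cstar_algebra mat \<Rightarrow> ('a mat \<times> 'a mat) set" where
  "K0_class p \<equiv> K0_diff p (0\<^sub>m 0 0)"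

definition K0_add :: "('a::unital_cstar_algebra mat \<times> 'a mat) set \<Rightarrow> ('a mat \<times> 'a mat) set \<Rightarrow>
    ('a mat \<times> 'a mat) set" where
  "K0_add X Y = (\<Union>(p, q)\<in>X. \<Union>(p', q')\<in>Y. K0_diff (p \<oplus>\<^sub>m p') (q \<oplus>\<^sub>m q'))"

text \<open>The positive cone consists of the classes of projections.\<close>

definition K0 ::
  "'a::unital_cstar_algebra itself \<Rightarrow> ('a mat \<times> 'a mat) set unital_po_group" where
  "K0 _ =
     \<lparr> carrier = (projections \<times> projections) // K0_rel,
       mult = K0_add,
       one = K0_class (0\<^sub>m 0 0),
       leq = (\<lambda>X Y. \<exists>p\<in>projections. Y = K0_add X (K0_class p)),
       ounit = K0_class (1\<^sub>m 1) \<rparr>"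

section \<open>The unital lattice-ordered group \<open>(M\<^sub>1, 1)\<close>\<close>

definition pw_integer_linear :: "(real \<Rightarrow> real) \<Rightarrow> bool" where
  "pw_integer_linear f \<longleftrightarrow>
     (\<exists>(k::nat) (t::nat \<Rightarrow> real). t 0 = 0 \<and> t k = 1 \<and> (\<forall>i<k. t i < t (Suc i)) \<and>
        (\<forall>i<k. \<exists>a b :: int. \<forall>x\<in>{t i..t (Suc i)}. f x = of_int a * x + of_int b))"

text \<open>
  Functions on \<open>[0,1]\<close> are represented by extensional functions on \<open>real\<close>.
\<close>

definition M1 :: "(real \<Rightarrow> real) unital_po_group" where
  "M1 =
     \<lparr> carrier = {f \<in> extensional {0..1}. continuous_on {0..1} f \<and> pw_integer_linear f},
       mult = (\<lambda>f g. \<lambda>x\<in>{0..1}. f x + g x),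
       one = (\<lambda>x\<in>{0..1}. 0),
       leq = (\<lambda>f g. \<forall>x\<in>{0..1}. f x \<le> g x),
       ounit = (\<lambda>x\<in>{0..1}. 1) \<rparr>"

text \<open>The algebra is defined up to isomorphism only, hence a predicate.\<close>

definition Farey_Stern_Brocot_AF :: "'a::unital_cstar_algebra itself \<Rightarrow> bool" where
  "Farey_Stern_Brocot_AF A \<longleftrightarrow>
     unital_AF_algebra A \<and> unital_po_group_iso (K0 A) M1 \<noteq> {}"

section \<open>Finite-dimensional representations\<close>

text \<open>
  A *-homomorphism into \<open>B(\<complex>\<^sup>n)\<close>, i.e. into the complex \<open>n \<times> n\<close> matrices.  It need not be unital.
\<close>

definition fd_representation ::
  "nat \<Rightarrow> ('a::unital_cstar_algebra \<Rightarrow> complex mat) \<Rightarrow> bool" where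
  "fd_representation n \<pi> \<longleftrightarrow>
     (\<forall>a. \<pi> a \<in> carrier_mat n n) \<and>
     (\<forall>a b. \<pi> (a + b) = \<pi> a + \<pi> b) \<and>
     (\<forall>c a. \<pi> (c *\<^sub>C a) = c \<cdot>\<^sub>m \<pi> a) \<and>
     (\<forall>a b. \<pi> (a * b) = \<pi> a * \<pi> b) \<and>
     (\<forall>a. \<pi> (star a) = mat_adjoint (\<pi> a))"

definition residually_finite_dimensional :: "'a::unital_cstar_algebra itself \<Rightarrow> bool" where
  "residually_finite_dimensional _ \<longleftrightarrow>
     (\<forall>a::'a. a \<noteq> 0 \<longrightarrow> (\<exists>n \<pi>. fd_representation n \<pi> \<and> \<pi> a \<noteq> 0\<^sub>m n n))"

end

theory Submission
  imports Defs "HOL-Library.Function_Algebras"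
begin

text \<open>
  Let \<open>B n\<close> be an increasing sequence of finite-dimensional subalgebras with dense union and let
  \<open>a \<noteq> 0\<close>.  Approximate \<open>a\<close> by some \<open>b \<in> B N\<close> and let \<open>p \<in> B N\<close> be an eigenprojection of
  \<open>b\<^sup>* b\<close> for the eigenvalue \<open>\<parallel>b\<parallel>\<^sup>2\<close>.  By stable finiteness \<open>[p] \<noteq> 0\<close> in \<open>K\<^sub>0\<close>, so the function
  in \<open>M\<^sub>1\<close> corresponding to \<open>[p]\<close> is positive at some rational \<open>k/l\<close>.  Let \<open>\<mu>\<close> send a projection to
  the value at \<open>k/l\<close> of the function corresponding to its class: \<open>\<mu>\<close> is additive, takes values
  in \<open>(1/l)\<int>\<close>, and \<open>\<mu> 1 = 1\<close>.  Choose minimal projections \<open>g n\<close> of \<open>B (N + n)\<close> with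
  \<open>p \<ge> g 0 \<ge> g 1 \<ge> \<dots>\<close> and \<open>\<mu> (g n) > 0\<close>, hence \<open>\<mu> (g n) \<ge> 1/l\<close>.  The relations
  \<open>g n * x * g n = \<omega> x * g n\<close> define a state \<open>\<omega>\<close>.  Orthonormal vectors of its GNS space yield
  pairwise orthogonal projections equivalent to \<open>g n\<close>, so the GNS space has dimension at most \<open>l\<close>;
  and \<open>\<omega> (a\<^sup>* a)\<close> is close to \<open>\<omega> (b\<^sup>* b) = \<parallel>b\<parallel>\<^sup>2\<close>, so \<open>a\<close> acts nontrivially on it.
\<close>

section \<open>Projections and norms\<close>

lemma star_zero [simp]: "star (0::'a::unital_cstar_algebra) = 0"
  using star_scaleC[of 0 "0::'a"] by simp

lemma star_minus [simp]: "star (- a) = - star (a::'a::unital_cstar_algebra)"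
  using star_add[of a "- a"] by (simp add: eq_neg_iff_add_eq_0 add.commute)

lemma star_diff: "star (a - b) = star a - star (b::'a::unital_cstar_algebra)"
  using star_add[of a "- b"] by simp

lemma star_one [simp]: "star (1::'a::unital_cstar_algebra) = 1"
  by (metis mult_1 mult_1_right star_mult star_star)

lemma star_scaleR: "star (r *\<^sub>R x) = r *\<^sub>R star (x::'a::unital_cstar_algebra)"
  by (metis complex_cnj_complex_of_real scaleC_of_real star_scaleC)

lemma star_sum: "star (\<Sum>i\<in>I. f i) = (\<Sum>i\<in>I. star (f i :: 'a::unital_cstar_algebra))"
  by (induction I rule: infinite_finite_induct) (auto simp: star_add)

lemma star_mult_self_eq_0 [simp]: "star a * a = 0 \<longleftrightarrow> a = (0::'a::unital_cstar_algebra)"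
  using cstar_identity[of a] by auto

lemma norm_star [simp]: "norm (star a) = norm (a::'a::unital_cstar_algebra)"
proof -
  have le: "norm b \<le> norm (star b)" for b :: 'a
  proof (cases "b = 0")
    case False
    have "norm b * norm b \<le> norm (star b) * norm b"
      using cstar_identity[of b] norm_mult_ineq[of "star b" b] by (simp add: power2_eq_square)
    then show ?thesis using False by simp
  qed simp
  from le[of a] le[of "star a"] show ?thesis by (simp add: star_star)
qed

lemma bounded_linear_star: "bounded_linear (star :: 'a::unital_cstar_algebra \<Rightarrow> 'a)"
  by (rule bounded_linear_intro[of _ 1]) (auto simp: star_add star_scaleR)

definition is_projection :: "'a::unital_cstar_algebra \<Rightarrow> bool" where
  "is_projection p \<longleftrightarrow> p * p = p \<and> star p = p"

lemma norm_projection: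
  assumes "is_projection p" "p \<noteq> (0::'a::unital_cstar_algebra)"
  shows "norm p = 1"
  using assms cstar_identity[of p] by (simp add: is_projection_def power2_eq_square)

text \<open>All powers of \<open>h\<close> are selfadjoint, so the C*-identity squares the norm at
  each doubling of the exponent.\<close>

lemma norm_selfadj_power:
  assumes "star h = (h::'a::unital_cstar_algebra)"
  shows "norm (h ^ 2 ^ k) = norm h ^ 2 ^ k"
proof (induction k)
  case (Suc k)
  have "star (h ^ n) = h ^ n" for n
    by (induction n) (auto simp: star_mult assms power_commutes)
  then have "norm (h ^ 2 ^ Suc k) = (norm (h ^ 2 ^ k))\<^sup>2"
    using cstar_identity[of "h ^ 2 ^ k"] by (simp add: power_add[symmetric] mult_2)
  then show ?case using Suc by (simp add: power_mult[symmetric] mult.commute)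
qed simp

text \<open>The mixed terms of \<open>(x + y) ^ n\<close> vanish, so along the exponents
  \<open>2 ^ k\<close> the norm of \<open>x + y\<close> obeys
  \<open>norm (x + y) ^ 2 ^ k \<le> 2 * m ^ 2 ^ k\<close>. The factor 2 disappears after taking
  roots; the proof phrases this as a contradiction with \<open>(m / c) ^ n\<close> becoming
  small.\<close>

lemma norm_orthogonal_sum_le:
  fixes x y :: "'a::unital_cstar_algebra"
  assumes x: "star x = x" and y: "star y = y" and xy: "x * y = 0" and yx: "y * x = 0"
  shows "norm (x + y) \<le> max (norm x) (norm y)"
proof (rule ccontr)
  define m where "m = max (norm x) (norm y)"
  assume "\<not> norm (x + y) \<le> max (norm x) (norm y)"
  then have lt: "m < norm (x + y)" by (simp only: m_def not_le)
  have "m \<ge> 0" by (simp add: m_def le_max_iff_disj)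
  have pw: "(x + y) ^ Suc n = x ^ Suc n + y ^ Suc n" for n
  proof (induction n)
    case (Suc n)
    have "(x + y) ^ Suc (Suc n) = (x + y) * (x ^ Suc n + y ^ Suc n)"
      using Suc by simp
    also have "\<dots> = x ^ Suc (Suc n) + (x * y) * y ^ n + (y * x) * x ^ n + y ^ Suc (Suc n)"
      by (simp add: distrib_left distrib_right mult.assoc)
    finally show ?case by (simp add: xy yx)
  qed simp
  have le: "norm (x + y) ^ 2 ^ k \<le> 2 * m ^ 2 ^ k" for k
  proof -
    have "norm (x + y) ^ 2 ^ k = norm ((x + y) ^ 2 ^ k)"
      by (rule norm_selfadj_power[symmetric]) (simp add: star_add x y)
    also have "(x + y) ^ 2 ^ k = x ^ 2 ^ k + y ^ 2 ^ k"
      using pw[of "2 ^ k - 1"] by simp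
    also have "norm \<dots> \<le> norm x ^ 2 ^ k + norm y ^ 2 ^ k"
      by (metis norm_triangle_ineq norm_selfadj_power x y)
    also have "\<dots> \<le> m ^ 2 ^ k + m ^ 2 ^ k"
      by (intro add_mono power_mono) (auto simp: m_def)
    finally show ?thesis by simp
  qed
  define c where "c = norm (x + y)"
  have "c > 0" using lt \<open>m \<ge> 0\<close> unfolding c_def by linarith
  have "m / c < 1" "0 \<le> m / c" using lt \<open>m \<ge> 0\<close> \<open>c > 0\<close> by (auto simp: c_def)
  then obtain n where n: "(m / c) ^ n < 1 / 2"
    using real_arch_pow_inv[of "1/2" "m / c"] by auto
  have "(m / c) ^ 2 ^ n \<le> (m / c) ^ n"
    using \<open>m / c < 1\<close> \<open>0 \<le> m / c\<close> by (intro power_decreasing) (auto intro: less_imp_le less_exp)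
  with n have "m ^ 2 ^ n / c ^ 2 ^ n < 1 / 2"
    unfolding power_divide by linarith
  then show False using le[of n] \<open>c > 0\<close> by (simp add: c_def[symmetric] field_simps)
qed

text \<open>Not necessarily unital, so that the corners \<open>g B g\<close> of \<open>B\<close> are covered.\<close>

definition fd_star_subalgebra :: "'a::unital_cstar_algebra set \<Rightarrow> bool" where
  "fd_star_subalgebra B \<longleftrightarrow>
     complex_vector.subspace B \<and> (\<forall>a\<in>B. \<forall>b\<in>B. a * b \<in> B) \<and> (\<forall>a\<in>B. star a \<in> B) \<and>
     (\<exists>S. finite S \<and> B \<subseteq> complex_vector.span S)"

lemma fd_star_subalgebraD:
  assumes "fd_star_subalgebra B"
  shows "0 \<in> B" "a \<in> B \<Longrightarrow> b \<in> B \<Longrightarrow> a + b \<in> B" "a \<in> B \<Longrightarrow> b \<in> B \<Longrightarrow> a - b \<in> B"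
    "a \<in> B \<Longrightarrow> c *\<^sub>C a \<in> B" "a \<in> B \<Longrightarrow> b \<in> B \<Longrightarrow> a * b \<in> B" "a \<in> B \<Longrightarrow> star a \<in> B"
  using assms unfolding fd_star_subalgebra_def
  by (auto intro: complex_vector.subspace_0 complex_vector.subspace_add
      complex_vector.subspace_diff complex_vector.subspace_scale)

text \<open>The descent step for the induction on dimension and for the choice of a least corner
  below. The finite \<open>S\<close> keeps the bases finite, so that \<open>dim\<close>, a
  cardinality, really measures size.\<close>

lemma dim_psubset_less:
  fixes B B' :: "'a::unital_cstar_algebra set"
  assumes B': "complex_vector.subspace B'" and sub: "B' \<subseteq> B"
    and S: "finite S" "B \<subseteq> complex_vector.span S" and x: "x \<in> B" "x \<notin> B'"
  shows "complex_vector.dim B' < complex_vector.dim B"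
proof -
  obtain T where T: "T \<subseteq> B" "complex_vector.independent T" "B \<subseteq> complex_vector.span T"
    "card T = complex_vector.dim B"
    by (rule complex_vector.basis_exists)
  obtain T' where T': "T' \<subseteq> B'" "complex_vector.independent T'" "B' \<subseteq> complex_vector.span T'"
    "card T' = complex_vector.dim B'"
    by (rule complex_vector.basis_exists)
  have "finite T"
    using complex_vector.independent_span_bound[OF S(1) T(2)] T(1) S(2) by blast
  have "complex_vector.span T' \<subseteq> B'"
    using T'(1) B' by (rule complex_vector.span_minimal)
  then have "x \<notin> complex_vector.span T'" using x(2) by blast
  then have ind: "complex_vector.independent (insert x T')"
    using T'(2) by (rule complex_vector.independent_insertI)
  have "insert x T' \<subseteq> complex_vector.span T"
    using T'(1) sub x(1) T(3) by blast
  from complex_vector.independent_span_bound[OF \<open>finite T\<close> ind this]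
  have "finite (insert x T')" "card (insert x T') \<le> card T" by auto
  moreover have "x \<notin> T'" using T'(1) x(2) by blast
  ultimately show ?thesis using T(4) T'(4) by simp
qed

section \<open>Spectral theory in finite-dimensional subalgebras\<close>

lemma linear_relation_exists:
  fixes f :: "nat \<Rightarrow> 'a::unital_cstar_algebra"
  assumes S: "finite S" "range f \<subseteq> complex_vector.span S"
  obtains I c where "finite I" "(\<Sum>i\<in>I. c i *\<^sub>C f i) = 0" "\<exists>i\<in>I. c i \<noteq> 0"
proof (cases "inj f")
  case True
  then have "infinite (range f)" by (simp add: finite_image_iff)
  then have "complex_vector.dependent (range f)"
    using complex_vector.independent_span_bound[OF S(1) _ S(2)] by blast
  then obtain T u where T: "finite T" "T \<subseteq> range f" "(\<Sum>v\<in>T. u v *\<^sub>C v) = 0" "\<exists>v\<in>T. u v \<noteq> 0"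
    unfolding complex_vector.dependent_explicit by blast
  obtain I where I: "T = f ` I" "finite I"
    using T(1,2) by (metis finite_subset_image)
  have "(\<Sum>i\<in>I. u (f i) *\<^sub>C f i) = 0"
    using T(3) True unfolding I(1) by (subst (asm) sum.reindex) (auto intro: inj_on_subset)
  moreover have "\<exists>i\<in>I. u (f i) \<noteq> 0" using T(4) I(1) by blast
  ultimately show ?thesis using that[of I "\<lambda>i. u (f i)"] I(2) by blast
next
  \<comment> \<open>Dependence is a property of sets, and the range of a sequence with repetitions
    may well be independent; two equal terms then give the relation directly.\<close>
  case False
  then obtain i j where ij: "i \<noteq> j" "f i = f j" by (auto simp: inj_on_def)
  show ?thesis
    by (rule that[of "{i, j}" "\<lambda>k. if k = i then 1 else -1"]) (use ij in auto)
qed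

text \<open>Evaluation of \<open>X * q\<close> at \<open>h\<close>: without constant term, hence inside any algebra containing \<open>h\<close>.\<close>

definition eval0 :: "'a::unital_cstar_algebra \<Rightarrow> complex poly \<Rightarrow> 'a" where
  "eval0 h q = (\<Sum>i\<le>degree q. coeff q i *\<^sub>C h ^ Suc i)"

lemma eval0_altdef: "degree q \<le> n \<Longrightarrow> eval0 h q = (\<Sum>i\<le>n. coeff q i *\<^sub>C h ^ Suc i)"
  unfolding eval0_def by (intro sum.mono_neutral_left) (auto simp: coeff_eq_0)

text \<open>Splitting a root off an annihilating polynomial turns its vanishing at \<open>h\<close>
  into an eigenvalue equation.\<close>

lemma eval0_linear_factor: "eval0 h ([:- \<alpha>, 1:] * q) = h * eval0 h q - \<alpha> *\<^sub>C eval0 h q"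
proof -
  define n where "n = degree q"
  have "eval0 h ([:- \<alpha>, 1:] * q) = (\<Sum>i\<le>Suc n. coeff ([:- \<alpha>, 1:] * q) i *\<^sub>C h ^ Suc i)"
    by (rule eval0_altdef) (use degree_mult_le[of "[:- \<alpha>, 1:]" q] in \<open>simp add: n_def\<close>)
  also have "\<dots> = (\<Sum>i\<le>Suc n. coeff (pCons 0 q) i *\<^sub>C h ^ Suc i) - (\<Sum>i\<le>Suc n. (\<alpha> * coeff q i) *\<^sub>C h ^ Suc i)"
    unfolding sum_subtractf[symmetric]
    by (intro sum.cong) (auto simp flip: complex_vector.scale_left_diff_distrib)
  also have "(\<Sum>i\<le>Suc n. coeff (pCons 0 q) i *\<^sub>C h ^ Suc i) = (\<Sum>i\<le>n. coeff q i *\<^sub>C h ^ Suc (Suc i))"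
    unfolding sum.atMost_Suc_shift by simp
  also have "\<dots> = h * eval0 h q"
    unfolding eval0_def n_def by (simp add: sum_distrib_left scaleC_mult_right)
  also have "(\<Sum>i\<le>Suc n. (\<alpha> * coeff q i) *\<^sub>C h ^ Suc i) = \<alpha> *\<^sub>C (\<Sum>i\<le>Suc n. coeff q i *\<^sub>C h ^ Suc i)"
    by (simp add: complex_vector.scale_sum_right scaleC_scaleC scaleC_add_right)
  also have "(\<Sum>i\<le>Suc n. coeff q i *\<^sub>C h ^ Suc i) = eval0 h q"
    by (rule eval0_altdef[symmetric]) (simp add: n_def)
  finally show ?thesis .
qed

text \<open>The powers of \<open>h\<close> are linearly dependent, so some nonzero polynomial is
  annihilating. In one of least degree, a root \<open>\<alpha>\<close> can be split off, and the
  cofactor no longer annihilates. The eigenvector is thus itself a polynomial in \<open>h\<close>,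
  which later gives its commutation properties.\<close>

lemma exists_eigenvector:
  assumes B: "fd_star_subalgebra B" and h: "h \<in> B" "h \<noteq> (0::'a::unital_cstar_algebra)"
  obtains \<alpha> q where "eval0 h q \<noteq> 0" "h * eval0 h q = \<alpha> *\<^sub>C eval0 h q"
proof -
  obtain S where S: "finite S" "B \<subseteq> complex_vector.span S"
    using B by (auto simp: fd_star_subalgebra_def)
  have hpow: "h ^ Suc n \<in> B" for n
    by (induction n) (use h fd_star_subalgebraD(5)[OF B] in auto)
  obtain I c where I: "finite I" "(\<Sum>i\<in>I. c i *\<^sub>C h ^ Suc i) = 0" "\<exists>i\<in>I. c i \<noteq> 0"
    using linear_relation_exists[OF S(1), of "\<lambda>i. h ^ Suc i"] S(2) hpow by blast
  define q0 where "q0 = (\<Sum>i\<in>I. monom (c i) i)"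
  have coeff: "coeff q0 i = (if i \<in> I then c i else 0)" for i
    using I(1) by (simp add: q0_def coeff_sum)
  have "eval0 h q0 = 0"
  proof -
    have "eval0 h q0 = (\<Sum>i\<le>Max (insert (degree q0) I). coeff q0 i *\<^sub>C h ^ Suc i)"
      by (rule eval0_altdef) (use I(1) in simp)
    also have "\<dots> = (\<Sum>i\<in>I. coeff q0 i *\<^sub>C h ^ Suc i)"
      by (rule sum.mono_neutral_right) (use I(1) in \<open>auto simp: coeff Max_ge_iff\<close>)
    also have "\<dots> = (\<Sum>i\<in>I. c i *\<^sub>C h ^ Suc i)" by (rule sum.cong) (auto simp: coeff)
    finally show ?thesis using I(2) by simp
  qed
  moreover have "q0 \<noteq> 0" using I(3) coeff by (metis coeff_0)
  ultimately have "\<exists>q. (q \<noteq> 0 \<and> eval0 h q = 0) \<and>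
    (\<forall>r. (r \<noteq> 0 \<and> eval0 h r = 0) \<longrightarrow> degree q \<le> degree r)"
    by (intro ex_has_least_nat[of "\<lambda>q. q \<noteq> 0 \<and> eval0 h q = 0" q0 degree]) blast
  then obtain q where q: "q \<noteq> 0" "eval0 h q = 0"
    and least: "\<And>r. r \<noteq> 0 \<Longrightarrow> eval0 h r = 0 \<Longrightarrow> degree q \<le> degree r"
    by blast
  \<comment> \<open>A constant \<open>q\<close> stands for a multiple of \<open>h\<close> itself,
    because \<open>eval0\<close> carries an extra factor \<open>h\<close>.\<close>
  have "degree q \<noteq> 0"
  proof
    assume "degree q = 0"
    then have "coeff q 0 \<noteq> 0" using q(1) \<open>degree q = 0\<close> leading_coeff_0_iff[of q] by simp
    moreover have "coeff q 0 *\<^sub>C h = 0" using q(2) \<open>degree q = 0\<close> by (simp add: eval0_def)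
    ultimately show False using h(2) by simp
  qed
  then obtain \<alpha> where "poly q \<alpha> = 0"
    using fundamental_theorem_of_algebra[of q] by (auto simp: constant_degree)
  then obtain r where r: "q = [:- \<alpha>, 1:] * r" by (auto simp: poly_eq_0_iff_dvd elim: dvdE)
  with q(1) have "r \<noteq> 0" by auto
  then have "degree q = Suc (degree r)" unfolding r by (subst degree_mult_eq) auto
  with least[of r] \<open>r \<noteq> 0\<close> have "eval0 h r \<noteq> 0" by force
  moreover have "h * eval0 h r = \<alpha> *\<^sub>C eval0 h r" using q(2) unfolding r eval0_linear_factor by simp
  ultimately show ?thesis by (rule that)
qed

text \<open>The eigenvector \<open>y\<close> is a polynomial in \<open>h\<close>, hence normal, and
  acts as a scalar \<open>c\<close> on the \<open>\<alpha>\<close>-eigenvectors of \<open>h\<close>,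
  among them \<open>y\<close>. Therefore \<open>star y * y\<close> is an eigenvector whose square is
  a positive multiple of itself, and rescaling gives the projection.\<close>

lemma exists_eigenprojection:
  assumes B: "fd_star_subalgebra B" and h: "h \<in> B" "h \<noteq> (0::'a::unital_cstar_algebra)" "star h = h"
  obtains r :: real and p where "p \<in> B" "is_projection p" "p \<noteq> 0" "h * p = r *\<^sub>R p"
proof -
  obtain \<alpha> q where y0: "eval0 h q \<noteq> 0" "h * eval0 h q = \<alpha> *\<^sub>C eval0 h q"
    by (rule exists_eigenvector[OF B h(1,2)])
  define y where "y = eval0 h q"
  have y: "y \<noteq> 0" "h * y = \<alpha> *\<^sub>C y" using y0 by (auto simp: y_def)
  have hpow: "h ^ Suc n \<in> B" for n
    by (induction n) (use h fd_star_subalgebraD(5)[OF B] in auto)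
  have "y \<in> B"
    unfolding y_def eval0_def using B hpow
    by (intro complex_vector.subspace_sum complex_vector.subspace_scale)
      (auto simp: fd_star_subalgebra_def)
  have comm: "z * y = y * z" if "z * h = h * z" for z
  proof -
    have zh: "z * h ^ n = h ^ n * z" for n
      using that by (simp add: power_commuting_commutes)
    show ?thesis
      by (simp only: y_def eval0_def sum_distrib_left sum_distrib_right scaleC_mult_left
          scaleC_mult_right zh[of "Suc _"])
  qed
  \<comment> \<open>Two applications of \<open>comm\<close>: first to \<open>h\<close>, then, after
    taking adjoints, to \<open>star y\<close>. The outcome is normality of \<open>y\<close>.\<close>
  have hy: "h * y = y * h" by (rule comm) simp
  then have hys: "star y * h = h * star y" by (metis h(3) star_mult)
  then have yys: "star y * y = y * star y" by (rule comm)
  define k where "k = star y * y"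
  have "k \<noteq> 0" using y(1) by (simp add: k_def)
  have "star k = k" by (simp add: k_def star_mult star_star)
  have hk: "h * k = \<alpha> *\<^sub>C k"
  proof -
    have "h * k = (h * star y) * y" by (simp add: k_def mult.assoc)
    also have "\<dots> = star y * (h * y)" by (simp only: hys[symmetric] mult.assoc)
    finally show ?thesis by (simp add: y(2) scaleC_mult_right k_def)
  qed
  \<comment> \<open>The commuting selfadjoint elements \<open>h\<close> and \<open>k\<close> have a
    selfadjoint product, so the eigenvalue is real.\<close>
  have "cnj \<alpha> *\<^sub>C k = star (h * k)" by (simp add: hk star_scaleC \<open>star k = k\<close>)
  also have "\<dots> = h * k"
  proof -
    have "k * h = star y * (y * h)" by (simp add: k_def mult.assoc)
    also have "\<dots> = (star y * h) * y" by (simp only: hy[symmetric] mult.assoc)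
    also have "\<dots> = h * k" by (simp only: hys k_def mult.assoc)
    finally show ?thesis by (simp add: star_mult h(3) \<open>star k = k\<close>)
  qed
  finally have "cnj \<alpha> = \<alpha>" using \<open>k \<noteq> 0\<close> hk by simp
  then have \<alpha>: "\<alpha> = complex_of_real (Re \<alpha>)" by (simp add: complex_eq_iff)
  \<comment> \<open>The value at \<open>\<alpha>\<close> of the polynomial \<open>X * q\<close> that
    \<open>eval0\<close> evaluates.\<close>
  define c where "c = (\<Sum>i\<le>degree q. coeff q i * \<alpha> ^ Suc i)"
  have pow: "h ^ n * x = \<alpha> ^ n *\<^sub>C x" if "h * x = \<alpha> *\<^sub>C x" for n x
  proof (induction n)
    case (Suc n)
    have "h ^ Suc n * x = h ^ n * (h * x)" by (simp add: power_commutes flip: mult.assoc)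
    then show ?case by (simp add: that scaleC_mult_right Suc scaleC_scaleC mult.commute)
  qed simp
  have yx: "y * x = c *\<^sub>C x" if "h * x = \<alpha> *\<^sub>C x" for x
    unfolding y_def eval0_def c_def
    by (simp only: sum_distrib_right scaleC_mult_left pow[OF that] scaleC_scaleC complex_vector.scale_sum_left)
  have yy: "y * y = c *\<^sub>C y" by (rule yx) (rule y(2))
  have yyss: "star y * star y = cnj c *\<^sub>C star y" by (metis yy star_mult star_scaleC)
  have "k * k = (star y * star y) * (y * y)"
  proof -
    have "k * k = star y * ((y * star y) * y)" by (simp add: k_def mult.assoc)
    also have "\<dots> = (star y * star y) * (y * y)" by (simp only: yys[symmetric] mult.assoc)
    finally show ?thesis .
  qed
  also have "\<dots> = (c * cnj c) *\<^sub>C k"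
    by (simp add: yy yyss k_def scaleC_mult_left scaleC_mult_right scaleC_scaleC)
  finally have kk: "k * k = (cmod c)\<^sup>2 *\<^sub>R k"
    by (simp only: complex_norm_square[symmetric] scaleC_of_real)
  have "k * k \<noteq> 0" using \<open>k \<noteq> 0\<close> \<open>star k = k\<close> by (metis star_mult_self_eq_0)
  then have cpos: "cmod c \<noteq> 0" using kk by auto
  define p where "p = (1 / (cmod c)\<^sup>2) *\<^sub>R k"
  show ?thesis
  proof
    show "p \<in> B"
      unfolding p_def k_def using fd_star_subalgebraD[OF B] \<open>y \<in> B\<close> by (metis scaleC_of_real)
    show "is_projection p"
      using cpos unfolding is_projection_def p_def
      by (simp add: kk star_scaleR \<open>star k = k\<close> power2_eq_square)
    show "p \<noteq> 0" using cpos \<open>k \<noteq> 0\<close> by (simp add: p_def)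
    show "h * p = Re \<alpha> *\<^sub>R p"
    proof -
      have "h * k = Re \<alpha> *\<^sub>R k" using hk \<alpha> scaleC_of_real by metis
      then show ?thesis by (simp add: p_def)
    qed
  qed
qed

text \<open>Induction on the dimension. If the eigenvalue found has modulus below
  \<open>norm h\<close>, its spectral part \<open>r *\<^sub>R p\<close> is split off; the rest is
  orthogonal to \<open>p\<close>, must carry the whole norm, and lives in a smaller algebra.\<close>

lemma exists_norm_eigenprojection:
  assumes B: "fd_star_subalgebra B" and h: "h \<in> B" "h \<noteq> (0::'a::unital_cstar_algebra)" "star h = h"
  obtains r :: real and p where "p \<in> B" "is_projection p" "p \<noteq> 0" "h * p = r *\<^sub>R p" "\<bar>r\<bar> = norm h"
proof -
  have "\<exists>p\<in>B. \<exists>r::real. is_projection p \<and> p \<noteq> 0 \<and> h * p = r *\<^sub>R p \<and> \<bar>r\<bar> = norm h"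
    using assms
  proof (induction "complex_vector.dim B" arbitrary: B h rule: less_induct)
    case less
    note B = less.prems(1) and h = less.prems(2-4)
    obtain r :: real and p where p: "p \<in> B" "is_projection p" "p \<noteq> 0" "h * p = r *\<^sub>R p"
      by (rule exists_eigenprojection[OF B h])
    have pp: "p * p = p" "star p = p" using p(2) by (auto simp: is_projection_def)
    have ph: "p * h = r *\<^sub>R p"
      by (metis h(3) p(4) pp(2) star_mult star_scaleR)
    show ?case
    proof (cases "\<bar>r\<bar> = norm h")
      case False
      define h' where "h' = h - r *\<^sub>R p"
      have ph': "p * h' = 0" "h' * p = 0"
        by (auto simp: h'_def right_diff_distrib left_diff_distrib ph p(4) pp)
      have h'B: "h' \<in> B"
        unfolding h'_def using fd_star_subalgebraD[OF B] h(1) p(1) by (metis scaleC_of_real)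
      have h's: "star h' = h'" by (simp add: h'_def star_diff star_scaleR h(3) pp)
      have nr: "norm (r *\<^sub>R p) = \<bar>r\<bar>" using norm_projection[OF p(2,3)] by simp
      have "\<bar>r\<bar> \<le> norm h"
      proof -
        have "\<bar>r\<bar> = norm (h * p)" using p(4) nr by simp
        also have "\<dots> \<le> norm h * norm p" by (rule norm_mult_ineq)
        finally show ?thesis using norm_projection[OF p(2,3)] by simp
      qed
      moreover have "norm h \<le> max \<bar>r\<bar> (norm h')"
      proof -
        have "norm (r *\<^sub>R p + h') \<le> max (norm (r *\<^sub>R p)) (norm h')"
          by (rule norm_orthogonal_sum_le) (simp_all add: star_scaleR pp h's ph')
        moreover have "r *\<^sub>R p + h' = h" by (simp add: h'_def)
        ultimately show ?thesis by (simp only: nr)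
      qed
      moreover have "norm h' \<le> norm h"
      proof -
        have "h' = h * (1 - p)" by (simp add: h'_def right_diff_distrib p(4))
        moreover have "norm (1 - p) \<le> 1"
        proof -
          have "is_projection (1 - p)"
            by (simp add: is_projection_def right_diff_distrib left_diff_distrib pp star_diff)
          then show ?thesis using norm_projection[of "1 - p"] by (cases "1 - p = 0") auto
        qed
        ultimately show ?thesis
          by (metis mult.right_neutral mult_left_mono norm_ge_zero norm_mult_ineq order_trans)
      qed
      \<comment> \<open>Since \<open>\<bar>r\<bar> < norm h\<close>, the maximum in the orthogonal
        decomposition can only be attained by \<open>h'\<close>.\<close>
      ultimately have nh': "norm h' = norm h" using False by linarith
      \<comment> \<open>The elements orthogonal to \<open>p\<close>. This algebra does not contain
        \<open>1\<close>, so the induction has to run over non-unital subalgebras; it misses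
        \<open>p\<close>, so its dimension is smaller.\<close>
      define B' where "B' = {b \<in> B. p * b = 0 \<and> b * p = 0}"
      have sub: "complex_vector.subspace B'"
        unfolding B'_def complex_vector.subspace_def using fd_star_subalgebraD[OF B]
        by (auto simp: distrib_left distrib_right scaleC_mult_left scaleC_mult_right)
      obtain S where S: "finite S" "B \<subseteq> complex_vector.span S"
        using B by (auto simp: fd_star_subalgebra_def)
      have fd: "fd_star_subalgebra B'"
        unfolding fd_star_subalgebra_def
      proof (intro conjI)
        show "\<forall>a\<in>B'. \<forall>b\<in>B'. a * b \<in> B'"
          unfolding B'_def using fd_star_subalgebraD[OF B]
          by (auto simp: mult.assoc) (simp flip: mult.assoc)
        show "\<forall>a\<in>B'. star a \<in> B'"
          unfolding B'_def using fd_star_subalgebraD[OF B]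
          by auto (metis pp(2) star_mult star_zero)+
        show "\<exists>S. finite S \<and> B' \<subseteq> complex_vector.span S"
          using S by (auto simp: B'_def)
      qed (rule sub)
      have "p \<notin> B'" using pp p(3) by (auto simp: B'_def)
      then have "complex_vector.dim B' < complex_vector.dim B"
        by (intro dim_psubset_less[OF sub _ S p(1)]) (auto simp: B'_def)
      moreover have "h' \<in> B'" using h'B ph' by (auto simp: B'_def)
      moreover have "h' \<noteq> 0" using nh' h(2) by auto
      ultimately obtain p' r' where p': "p' \<in> B'" "is_projection p'" "p' \<noteq> 0" "h' * p' = r' *\<^sub>R p'"
        "\<bar>r'\<bar> = norm h'"
        using less.hyps[OF _ fd _ _ h's] by blast
      have "h * p' = r' *\<^sub>R p'"
        using p'(1,4) by (simp add: h'_def B'_def left_diff_distrib)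
      then show ?thesis using p' nh' by (auto simp: B'_def)
    qed (use p in auto)
  qed
  then show ?thesis using that by blast
qed

lemma fd_star_subalgebra_corner:
  assumes B: "fd_star_subalgebra B" and g: "is_projection (g::'a::unital_cstar_algebra)"
  shows "fd_star_subalgebra {x \<in> B. g * x = x \<and> x * g = x}"
proof -
  have gg: "g * g = g" "star g = g" using g by (auto simp: is_projection_def)
  note BD = fd_star_subalgebraD[OF B]
  obtain S where S: "finite S" "B \<subseteq> complex_vector.span S"
    using B by (auto simp: fd_star_subalgebra_def)
  show ?thesis
    unfolding fd_star_subalgebra_def
  proof (intro conjI)
    show "complex_vector.subspace {x \<in> B. g * x = x \<and> x * g = x}"
      unfolding complex_vector.subspace_def using BD
      by (auto simp: distrib_left distrib_right scaleC_mult_left scaleC_mult_right)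
    show "\<forall>a\<in>{x \<in> B. g * x = x \<and> x * g = x}. \<forall>b\<in>{x \<in> B. g * x = x \<and> x * g = x}.
        a * b \<in> {x \<in> B. g * x = x \<and> x * g = x}"
      using BD by (auto simp: mult.assoc) (simp flip: mult.assoc)
    show "\<forall>a\<in>{x \<in> B. g * x = x \<and> x * g = x}. star a \<in> {x \<in> B. g * x = x \<and> x * g = x}"
      using BD by auto (metis gg(2) star_mult)+
    show "\<exists>S. finite S \<and> {x \<in> B. g * x = x \<and> x * g = x} \<subseteq> complex_vector.span S"
      using S by auto
  qed
qed

text \<open>Among the projections below \<open>p\<close> with positive value, one with a corner of
  least dimension is taken. If it split properly, additivity would give one of the two parts a
  positive value, and that part would have a smaller corner. Hence no selfadjoint element of the
  corner has an eigenprojection other than \<open>g\<close>, and the corner is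
  one-dimensional.\<close>

lemma exists_minimal_projection:
  fixes \<mu> :: "'a::unital_cstar_algebra \<Rightarrow> real"
  assumes B: "fd_star_subalgebra B"
    and add: "\<And>e f. is_projection e \<Longrightarrow> is_projection f \<Longrightarrow> e * f = 0 \<Longrightarrow> \<mu> (e + f) = \<mu> e + \<mu> f"
    and p: "p \<in> B" "is_projection p" "\<mu> p > 0"
  obtains g where "g \<in> B" "is_projection g" "p * g = g" "g * p = g" "\<mu> g > 0"
    "\<And>b. b \<in> B \<Longrightarrow> \<exists>c. g * b * g = c *\<^sub>C g"
proof -
  note BD = fd_star_subalgebraD[OF B]
  define corner where "corner g = {x \<in> B. g * x = x \<and> x * g = x}" for g
  define Q where "Q g \<longleftrightarrow> g \<in> B \<and> is_projection g \<and> p * g = g \<and> g * p = g \<and> \<mu> g > 0" for g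
  have "Q p" using p by (auto simp: Q_def is_projection_def)
  then obtain g where g: "Q g" and least: "\<And>f. Q f \<Longrightarrow> complex_vector.dim (corner g) \<le> complex_vector.dim (corner f)"
    using ex_has_least_nat[of Q p "\<lambda>g. complex_vector.dim (corner g)"] by blast
  have gB: "g \<in> B" and gp: "is_projection g" and pg: "p * g = g" "g * p = g" and mg: "\<mu> g > 0"
    using g by (auto simp: Q_def)
  have gg: "g * g = g" "star g = g" using gp by (auto simp: is_projection_def)
  have fdg: "fd_star_subalgebra (corner g)"
    unfolding corner_def by (rule fd_star_subalgebra_corner[OF B gp])
  have sub: False if f: "f \<in> corner g" "f \<noteq> g" "is_projection f" "\<mu> f > 0" for f
  proof -
    have fg: "f \<in> B" "g * f = f" "f * g = f" using f(1) by (auto simp: corner_def)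
    have "Q f" unfolding Q_def using f fg pg by (metis mult.assoc)
    moreover have "complex_vector.dim (corner f) < complex_vector.dim (corner g)"
    proof -
      obtain S where S: "finite S" "corner g \<subseteq> complex_vector.span S"
        using fdg by (auto simp: fd_star_subalgebra_def)
      have "complex_vector.subspace (corner f)"
        using fd_star_subalgebra_corner[OF B f(3)] by (simp add: fd_star_subalgebra_def corner_def)
      moreover have "corner f \<subseteq> corner g"
        unfolding corner_def using fg by auto (metis mult.assoc)+
      moreover have "g \<in> corner g" "g \<notin> corner f"
        using gB gg fg f(2) by (auto simp: corner_def)
      ultimately show ?thesis using dim_psubset_less[OF _ _ S] by blast
    qed
    ultimately show False using least by force
  qed
  have selfadj: "\<exists>c. u = c *\<^sub>C g" if u: "u \<in> corner g" "star u = u" for u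
  proof (cases "u = 0")
    case False
    then obtain r :: real and f where f: "f \<in> corner g" "is_projection f" "f \<noteq> 0" "u * f = r *\<^sub>R f"
      by (rule exists_eigenprojection[OF fdg u(1) _ u(2)])
    have fg: "f \<in> B" "g * f = f" "f * g = f" using f(1) by (auto simp: corner_def)
    have ff: "f * f = f" "star f = f" using f(2) by (auto simp: is_projection_def)
    show ?thesis
    proof (cases "f = g")
      case True
      then have "u = r *\<^sub>R g" using f(4) u(1) by (auto simp: corner_def)
      then show ?thesis by (metis scaleC_of_real)
    next
      case False
      have gf: "is_projection (g - f)" "g - f \<in> corner g" "f * (g - f) = 0" "g - f \<noteq> g"
        using gg ff fg gB BD(3) f(3)
        by (auto simp: is_projection_def corner_def right_diff_distrib left_diff_distrib star_diff)
      \<comment> \<open>Whichever of \<open>f\<close> and \<open>g - f\<close> has positive value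
        contradicts \<open>sub\<close>.\<close>
      have "\<mu> g = \<mu> f + \<mu> (g - f)" using add[OF f(2) gf(1,3)] by simp
      then have "\<mu> f > 0 \<or> \<mu> (g - f) > 0" using mg by linarith
      then show ?thesis using sub[OF f(1) False f(2)] sub[OF gf(2,4,1)] by blast
    qed
  qed (auto intro: exI[of _ 0])
  have "\<exists>c. g * b * g = c *\<^sub>C g" if b: "b \<in> B" for b
  proof -
    define x where "x = g * b * g"
    have x: "x \<in> corner g"
      using b gB BD gg by (auto simp: x_def corner_def mult.assoc) (simp flip: mult.assoc)
    note CD = fd_star_subalgebraD[OF fdg]
    \<comment> \<open>An arbitrary corner element is recovered from its two selfadjoint combinations
      \<open>x + star x\<close> and \<open>\<i> *\<^sub>C (x - star x)\<close>.\<close>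
    have "\<exists>c. x + star x = c *\<^sub>C g"
      by (rule selfadj) (use x CD in \<open>auto simp: star_add star_star add.commute\<close>)
    then obtain c where c: "x + star x = c *\<^sub>C g" ..
    have "\<exists>d. \<i> *\<^sub>C (x - star x) = d *\<^sub>C g"
      by (rule selfadj) (use x CD in \<open>auto simp: star_diff star_star star_scaleC
          complex_vector.scale_right_diff_distrib\<close>)
    then obtain d where d: "\<i> *\<^sub>C (x - star x) = d *\<^sub>C g" ..
    have "(- \<i>) *\<^sub>C \<i> *\<^sub>C (x - star x) = (- \<i> * d) *\<^sub>C g" by (simp only: d scaleC_scaleC)
    then have "x - star x = (- \<i> * d) *\<^sub>C g" by (simp add: scaleC_scaleC)
    with c have "(x + star x) + (x - star x) = (c - \<i> * d) *\<^sub>C g"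
      by (simp only: complex_vector.scale_left_distrib[symmetric]) (simp add: algebra_simps)
    then have "2 *\<^sub>C x = (c - \<i> * d) *\<^sub>C g"
      using complex_vector.scale_left_distrib[of 1 1 x] by simp
    then have "(1/2) *\<^sub>C 2 *\<^sub>C x = (1/2 * (c - \<i> * d)) *\<^sub>C g" by (simp only: scaleC_scaleC)
    then have "x = (1/2 * (c - \<i> * d)) *\<^sub>C g" by (simp add: scaleC_scaleC)
    then show ?thesis unfolding x_def by blast
  qed
  then show ?thesis using that gB gp pg mg by blast
qed

section \<open>Murray--von Neumann equivalence and \<open>K\<^sub>0\<close>\<close>

lemma dim_mat_star [simp]: "dim_row (mat_star A) = dim_col A" "dim_col (mat_star A) = dim_row A"
  by (auto simp: mat_star_def)

lemma mat_star_carrier [simp]: "mat_star A \<in> carrier_mat n m \<longleftrightarrow> A \<in> carrier_mat m n"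
  unfolding carrier_mat_def mem_Collect_eq dim_mat_star by (rule conj_commute)

lemma index_mat_star [simp]:
  "i < dim_col A \<Longrightarrow> j < dim_row A \<Longrightarrow> mat_star A $$ (i, j) = star (A $$ (j, i))"
  by (simp add: mat_star_def)

lemma mat_star_mat_star [simp]: "mat_star (mat_star A) = A"
  by (rule eq_matI) (auto simp: star_star)

lemma mat_star_mult:
  assumes "A \<in> carrier_mat n m" "B \<in> carrier_mat m k"
  shows "mat_star (A * B) = mat_star B * mat_star (A :: 'a::unital_cstar_algebra mat)"
  using assms by (intro eq_matI) (auto simp: scalar_prod_def star_sum star_mult)

lemma mat_star_zero [simp]: "mat_star (0\<^sub>m n m) = 0\<^sub>m m n"
  by (rule eq_matI) auto

lemma mat_star_four_block:
  assumes "A \<in> carrier_mat nr1 nc1" "B \<in> carrier_mat nr1 nc2"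
    "C \<in> carrier_mat nr2 nc1" "D \<in> carrier_mat nr2 nc2"
  shows "mat_star (four_block_mat A B C D) =
    four_block_mat (mat_star A) (mat_star C) (mat_star B) (mat_star D)"
  using assms by (intro eq_matI) auto

lemma mat_assoc:
  "dim_col A = dim_row B \<Longrightarrow> dim_col B = dim_row C \<Longrightarrow> (A * B) * C = A * (B * (C :: 'a::semiring_0 mat))"
  by (rule assoc_mult_mat[of _ "dim_row A" "dim_col A" _ "dim_col B" _ "dim_col C"]) auto

lemma projectionsD:
  assumes "p \<in> projections"
  shows "p \<in> carrier_mat (dim_row p) (dim_row p)" "p * p = p" "mat_star p = p" "dim_col p = dim_row p"
  using assms by (auto simp: projections_def)

section \<open>Murray-von Neumann equivalence as an equivalence relation\<close>

lemma mvn_refl: "p \<in> projections \<Longrightarrow> mvn_equiv p p"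
  unfolding mvn_equiv_def by (rule bexI[of _ p]) (simp_all only: projectionsD(1-3) simp_thms)

lemma mvn_sym:
  assumes "mvn_equiv p q"
  shows "mvn_equiv q p"
proof -
  obtain v where "v \<in> carrier_mat (dim_row q) (dim_row p)" "p = mat_star v * v" "q = v * mat_star v"
    using assms unfolding mvn_equiv_def by blast
  then show ?thesis
    unfolding mvn_equiv_def by (intro bexI[of _ "mat_star v"]) auto
qed

text \<open>The product \<open>w * v\<close> implements the equivalence: replacing
  \<open>mat_star w * w\<close> by \<open>v * mat_star v\<close>, and conversely, leaves the squares
  \<open>p * p\<close> and \<open>r * r\<close>.\<close>

lemma mvn_trans:
  assumes "p \<in> projections" "r \<in> projections" "mvn_equiv p q" "mvn_equiv q r"
  shows "mvn_equiv p r"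
proof -
  obtain v where v: "v \<in> carrier_mat (dim_row q) (dim_row p)" "p = mat_star v * v" "q = v * mat_star v"
    using assms(3) unfolding mvn_equiv_def by blast
  obtain w where w: "w \<in> carrier_mat (dim_row r) (dim_row q)" "q = mat_star w * w" "r = w * mat_star w"
    using assms(4) unfolding mvn_equiv_def by blast
  define a b c where "a = dim_row p" and "b = dim_row q" and "c = dim_row r"
  note vc = v(1)[folded a_def b_def] and wc = w(1)[folded b_def c_def]
  have dims: "dim_row v = b" "dim_col v = a" "dim_row w = c" "dim_col w = b"
    using vc wc by auto
  have wv: "mat_star (w * v) = mat_star v * mat_star w"
    by (rule mat_star_mult[OF wc vc])
  have "mat_star (w * v) * (w * v) = mat_star v * ((mat_star w * w) * v)"
    unfolding wv by (simp add: mat_assoc dims)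
  also have "mat_star w * w = v * mat_star v" using w(2) v(3) by (rule subst)
  also have "mat_star v * ((v * mat_star v) * v) = (mat_star v * v) * (mat_star v * v)"
    by (simp add: mat_assoc dims)
  also have "\<dots> = p" unfolding v(2)[symmetric] by (rule projectionsD(2)[OF assms(1)])
  finally have 1: "mat_star (w * v) * (w * v) = p" .
  have "(w * v) * mat_star (w * v) = w * ((v * mat_star v) * mat_star w)"
    unfolding wv by (simp add: mat_assoc dims)
  also have "v * mat_star v = mat_star w * w" using v(3) w(2) by (rule subst)
  also have "w * ((mat_star w * w) * mat_star w) = (w * mat_star w) * (w * mat_star w)"
    by (simp add: mat_assoc dims)
  also have "\<dots> = r" unfolding w(3)[symmetric] by (rule projectionsD(2)[OF assms(2)])
  finally have 2: "(w * v) * mat_star (w * v) = r" .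
  show ?thesis unfolding mvn_equiv_def
    by (rule bexI[of _ "w * v"]) (use 1 2 mult_carrier_mat[OF w(1) v(1)] in auto)
qed

section \<open>Direct sums up to equivalence\<close>

lemma dim_dsum [simp]:
  "dim_row (p \<oplus>\<^sub>m q) = dim_row p + dim_row q" "dim_col (p \<oplus>\<^sub>m q) = dim_col p + dim_col q"
  by (auto simp: dsum_def)

lemma dsum_assoc: "(p \<oplus>\<^sub>m q) \<oplus>\<^sub>m r = p \<oplus>\<^sub>m (q \<oplus>\<^sub>m r)"
  unfolding dsum_def using assoc_four_block_mat[of p q r] by simp

lemma dsum_zero [simp]: "p \<oplus>\<^sub>m 0\<^sub>m 0 0 = p" "0\<^sub>m 0 0 \<oplus>\<^sub>m p = p"
  by (auto simp: dsum_def intro!: eq_matI)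

lemma dsum_mult:
  assumes "dim_col p = dim_row p'" "dim_col q = dim_row q'"
  shows "(p \<oplus>\<^sub>m q) * (p' \<oplus>\<^sub>m q') = (p * p') \<oplus>\<^sub>m (q * (q' :: 'a::unital_cstar_algebra mat))"
  unfolding dsum_def
  by (subst mult_four_block_mat[of _ "dim_row p" "dim_col p" _ "dim_col q" _ "dim_row q" _ _ "dim_col p'" _ "dim_col q'"])
    (use assms in \<open>auto intro!: carrier_matI\<close>)

lemma mat_star_dsum: "mat_star (p \<oplus>\<^sub>m q) = mat_star p \<oplus>\<^sub>m mat_star q"
  unfolding dsum_def
  by (subst mat_star_four_block[of _ "dim_row p" "dim_col p" _ "dim_col q" _ "dim_row q"]) auto

lemma dsum_projections:
  assumes "p \<in> projections" "q \<in> projections"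
  shows "p \<oplus>\<^sub>m q \<in> projections"
  using assms by (simp add: projections_def mat_star_dsum dsum_mult)

lemma zero_projections [simp]: "0\<^sub>m n n \<in> projections"
  by (auto simp: projections_def)

lemma dsum_mvn_cong:
  assumes "mvn_equiv p p'" "mvn_equiv q q'"
  shows "mvn_equiv (p \<oplus>\<^sub>m q) (p' \<oplus>\<^sub>m q')"
proof -
  obtain v where v: "v \<in> carrier_mat (dim_row p') (dim_row p)" "p = mat_star v * v" "p' = v * mat_star v"
    using assms(1) unfolding mvn_equiv_def by blast
  obtain w where w: "w \<in> carrier_mat (dim_row q') (dim_row q)" "q = mat_star w * w" "q' = w * mat_star w"
    using assms(2) unfolding mvn_equiv_def by blast
  have "p \<oplus>\<^sub>m q = mat_star (v \<oplus>\<^sub>m w) * (v \<oplus>\<^sub>m w)"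
    unfolding mat_star_dsum using v(1) w(1) by (simp add: dsum_mult v(2,3)[symmetric] w(2,3)[symmetric])
  moreover have "p' \<oplus>\<^sub>m q' = (v \<oplus>\<^sub>m w) * mat_star (v \<oplus>\<^sub>m w)"
    unfolding mat_star_dsum using v(1) w(1) by (simp add: dsum_mult v(2,3)[symmetric] w(2,3)[symmetric])
  moreover have "v \<oplus>\<^sub>m w \<in> carrier_mat (dim_row (p' \<oplus>\<^sub>m q')) (dim_row (p \<oplus>\<^sub>m q))"
    using v(1) w(1) by auto
  ultimately show ?thesis unfolding mvn_equiv_def by blast
qed

lemma dsum_mvn_comm:
  assumes "p \<in> projections" "q \<in> projections"
  shows "mvn_equiv (p \<oplus>\<^sub>m q) (q \<oplus>\<^sub>m p)"
proof -
  define a b where "a = dim_row p" and "b = dim_row q"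
  have p: "p \<in> carrier_mat a a" "p * p = p" "mat_star p = p"
    and q: "q \<in> carrier_mat b b" "q * q = q" "mat_star q = q"
    using assms projectionsD by (auto simp: a_def b_def)
  \<comment> \<open>The matrix that exchanges the two blocks, cut down by \<open>p\<close> and
    \<open>q\<close>.\<close>
  define v where "v = four_block_mat (0\<^sub>m b a) q p (0\<^sub>m a b)"
  have vs: "mat_star v = four_block_mat (0\<^sub>m a b) p q (0\<^sub>m b a)"
    unfolding v_def by (subst mat_star_four_block[of _ b a _ b _ a]) (use p q in auto)
  have "mat_star v * v = p \<oplus>\<^sub>m q"
    unfolding vs unfolding v_def dsum_def
    by (subst mult_four_block_mat[of _ a b _ a _ b _ _ a _ b]) (use p q in auto)
  moreover have "v * mat_star v = q \<oplus>\<^sub>m p"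
    unfolding vs unfolding v_def dsum_def
    by (subst mult_four_block_mat[of _ b a _ b _ a _ _ b _ a]) (use p q in auto)
  moreover have "v \<in> carrier_mat (dim_row (q \<oplus>\<^sub>m p)) (dim_row (p \<oplus>\<^sub>m q))"
    using p q by (auto simp: v_def)
  ultimately show ?thesis unfolding mvn_equiv_def by (intro bexI[of _ v]) auto
qed

text \<open>With sums written as lists, each rearrangement of summands in the \<open>K0\<close>
  arguments reduces to an equality of multisets.\<close>

definition dsum_list :: "'a::unital_cstar_algebra mat list \<Rightarrow> 'a mat" where
  "dsum_list xs = foldr (\<oplus>\<^sub>m) xs (0\<^sub>m 0 0)"

lemma dsum_list_simps [simp]:
  "dsum_list [] = 0\<^sub>m 0 0" "dsum_list (x # xs) = x \<oplus>\<^sub>m dsum_list xs"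
  by (auto simp: dsum_list_def)

lemma dsum_list_append: "dsum_list (xs @ ys) = dsum_list xs \<oplus>\<^sub>m dsum_list ys"
  by (induction xs) (auto simp: dsum_assoc)

lemma dsum_list_projections: "set xs \<subseteq> projections \<Longrightarrow> dsum_list xs \<in> projections"
  by (induction xs) (auto intro: dsum_projections)

lemma dsum_list_permute:
  assumes "mset xs = mset ys" "set xs \<subseteq> projections"
  shows "mvn_equiv (dsum_list xs) (dsum_list ys)"
  using assms
proof (induction xs arbitrary: ys)
  case (Cons x xs)
  have "x \<in> set ys" using Cons.prems(1) by (metis list.set_intros(1) set_mset_mset)
  then obtain as bs where ys: "ys = as @ x # bs" by (meson split_list)
  then have m: "mset xs = mset (as @ bs)" using Cons.prems(1) by simp
  have "set ys \<subseteq> projections" using Cons.prems by (metis set_mset_mset)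
  then have P: "dsum_list as \<in> projections" "dsum_list bs \<in> projections" "x \<in> projections"
    "dsum_list xs \<in> projections" "dsum_list (as @ bs) \<in> projections"
    using Cons.prems ys by (auto intro!: dsum_list_projections)
  have "mvn_equiv (x \<oplus>\<^sub>m dsum_list xs) (x \<oplus>\<^sub>m dsum_list (as @ bs))"
    using Cons.IH[OF m] Cons.prems P by (intro dsum_mvn_cong mvn_refl) auto
  moreover have "mvn_equiv ((x \<oplus>\<^sub>m dsum_list as) \<oplus>\<^sub>m dsum_list bs) ((dsum_list as \<oplus>\<^sub>m x) \<oplus>\<^sub>m dsum_list bs)"
    using P by (intro dsum_mvn_cong mvn_refl dsum_mvn_comm) auto
  ultimately show ?case
    using mvn_trans[of "x \<oplus>\<^sub>m dsum_list xs" "dsum_list ys"] P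
    by (simp add: ys dsum_list_append dsum_assoc dsum_projections)
qed (auto intro: mvn_refl)

section \<open>The Grothendieck relation as a congruence\<close>

lemma equiv_K0_rel: "equiv (projections \<times> projections) (K0_rel :: (('a::unital_cstar_algebra mat \<times> 'a mat) \<times> _) set)"
proof (rule equivI)
  show "K0_rel \<subseteq> ((projections \<times> projections) \<times> (projections \<times> (projections :: 'a mat set)))"
    by (auto simp: K0_rel_def)
  show "refl_on (projections \<times> projections) (K0_rel :: (('a mat \<times> 'a mat) \<times> _) set)"
    unfolding refl_on_def K0_rel_def
    by (auto intro!: bexI[of _ "0\<^sub>m 0 0"] mvn_refl dsum_projections)
  show "sym (K0_rel :: (('a mat \<times> 'a mat) \<times> _) set)"
    unfolding sym_def K0_rel_def by (auto intro: mvn_sym)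
  show "trans (K0_rel :: (('a mat \<times> 'a mat) \<times> _) set)"
  proof (rule transI)
    fix x y z :: "'a mat \<times> 'a mat"
    assume xy: "(x, y) \<in> K0_rel" and yz: "(y, z) \<in> K0_rel"
    obtain p q p' q' p'' q'' where xyz: "x = (p, q)" "y = (p', q')" "z = (p'', q'')"
      by (cases x; cases y; cases z)
    obtain r where r: "r \<in> projections" "mvn_equiv (p \<oplus>\<^sub>m q' \<oplus>\<^sub>m r) (p' \<oplus>\<^sub>m q \<oplus>\<^sub>m r)"
      using xy by (auto simp: K0_rel_def xyz)
    obtain s where s: "s \<in> projections" "mvn_equiv (p' \<oplus>\<^sub>m q'' \<oplus>\<^sub>m s) (p'' \<oplus>\<^sub>m q' \<oplus>\<^sub>m s)"
      using yz by (auto simp: K0_rel_def xyz)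
    have P: "p \<in> projections" "q \<in> projections" "p' \<in> projections" "q' \<in> projections"
      "p'' \<in> projections" "q'' \<in> projections"
      using xy yz by (auto simp: K0_rel_def xyz)
    \<comment> \<open>Adding the two given equivalences leaves the middle pair \<open>p'\<close>,
      \<open>q'\<close> on both sides; it is absorbed into the stabilising summand together with
      \<open>r\<close> and \<open>s\<close>.\<close>
    define t where "t = p' \<oplus>\<^sub>m q' \<oplus>\<^sub>m r \<oplus>\<^sub>m s"
    have 1: "mvn_equiv (p \<oplus>\<^sub>m q'' \<oplus>\<^sub>m t) ((p \<oplus>\<^sub>m q' \<oplus>\<^sub>m r) \<oplus>\<^sub>m (p' \<oplus>\<^sub>m q'' \<oplus>\<^sub>m s))"
      using dsum_list_permute[of "[p, q'', p', q', r, s]" "[p, q', r, p', q'', s]"] P r(1) s(1)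
      by (simp add: t_def dsum_assoc)
    have 2: "mvn_equiv ((p \<oplus>\<^sub>m q' \<oplus>\<^sub>m r) \<oplus>\<^sub>m (p' \<oplus>\<^sub>m q'' \<oplus>\<^sub>m s)) ((p' \<oplus>\<^sub>m q \<oplus>\<^sub>m r) \<oplus>\<^sub>m (p'' \<oplus>\<^sub>m q' \<oplus>\<^sub>m s))"
      by (intro dsum_mvn_cong r s)
    have 3: "mvn_equiv ((p' \<oplus>\<^sub>m q \<oplus>\<^sub>m r) \<oplus>\<^sub>m (p'' \<oplus>\<^sub>m q' \<oplus>\<^sub>m s)) (p'' \<oplus>\<^sub>m q \<oplus>\<^sub>m t)"
      using dsum_list_permute[of "[p', q, r, p'', q', s]" "[p'', q, p', q', r, s]"] P r(1) s(1)
      by (simp add: t_def dsum_assoc)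
    have "mvn_equiv (p \<oplus>\<^sub>m q'' \<oplus>\<^sub>m t) (p'' \<oplus>\<^sub>m q \<oplus>\<^sub>m t)"
      by (rule mvn_trans[OF _ _ mvn_trans[OF _ _ 1 2] 3])
        (use P r(1) s(1) in \<open>auto simp: t_def intro!: dsum_projections\<close>)
    moreover have "t \<in> projections" using P r(1) s(1) by (auto simp: t_def intro!: dsum_projections)
    ultimately show "(x, z) \<in> K0_rel" using P by (auto simp: K0_rel_def xyz)
  qed
qed

lemma K0_diff_eq_iff:
  assumes "p \<in> projections" "q \<in> projections" "p' \<in> projections" "q' \<in> projections"
  shows "K0_diff p q = K0_diff p' q' \<longleftrightarrow> ((p, q), (p', q')) \<in> K0_rel"
  unfolding K0_diff_def by (rule eq_equiv_class_iff[OF equiv_K0_rel]) (use assms in auto)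

lemma K0_rel_dsum:
  assumes "((p, q), (p', q')) \<in> K0_rel" "((a, b), (a', b')) \<in> K0_rel"
  shows "((p \<oplus>\<^sub>m a, q \<oplus>\<^sub>m b), (p' \<oplus>\<^sub>m a', q' \<oplus>\<^sub>m b')) \<in> K0_rel"
proof -
  obtain r where r: "r \<in> projections" "mvn_equiv (p \<oplus>\<^sub>m q' \<oplus>\<^sub>m r) (p' \<oplus>\<^sub>m q \<oplus>\<^sub>m r)"
    using assms(1) by (auto simp: K0_rel_def)
  obtain s where s: "s \<in> projections" "mvn_equiv (a \<oplus>\<^sub>m b' \<oplus>\<^sub>m s) (a' \<oplus>\<^sub>m b \<oplus>\<^sub>m s)"
    using assms(2) by (auto simp: K0_rel_def)
  have P: "p \<in> projections" "q \<in> projections" "p' \<in> projections" "q' \<in> projections"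
    "a \<in> projections" "b \<in> projections" "a' \<in> projections" "b' \<in> projections"
    using assms by (auto simp: K0_rel_def)
  define t where "t = r \<oplus>\<^sub>m s"
  have 1: "mvn_equiv ((p \<oplus>\<^sub>m a) \<oplus>\<^sub>m (q' \<oplus>\<^sub>m b') \<oplus>\<^sub>m t) ((p \<oplus>\<^sub>m q' \<oplus>\<^sub>m r) \<oplus>\<^sub>m (a \<oplus>\<^sub>m b' \<oplus>\<^sub>m s))"
    using dsum_list_permute[of "[p, a, q', b', r, s]" "[p, q', r, a, b', s]"] P r(1) s(1)
    by (simp add: t_def dsum_assoc)
  have 2: "mvn_equiv ((p \<oplus>\<^sub>m q' \<oplus>\<^sub>m r) \<oplus>\<^sub>m (a \<oplus>\<^sub>m b' \<oplus>\<^sub>m s)) ((p' \<oplus>\<^sub>m q \<oplus>\<^sub>m r) \<oplus>\<^sub>m (a' \<oplus>\<^sub>m b \<oplus>\<^sub>m s))"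
    by (intro dsum_mvn_cong r s)
  have 3: "mvn_equiv ((p' \<oplus>\<^sub>m q \<oplus>\<^sub>m r) \<oplus>\<^sub>m (a' \<oplus>\<^sub>m b \<oplus>\<^sub>m s)) ((p' \<oplus>\<^sub>m a') \<oplus>\<^sub>m (q \<oplus>\<^sub>m b) \<oplus>\<^sub>m t)"
    using dsum_list_permute[of "[p', q, r, a', b, s]" "[p', a', q, b, r, s]"] P r(1) s(1)
    by (simp add: t_def dsum_assoc)
  have "mvn_equiv ((p \<oplus>\<^sub>m a) \<oplus>\<^sub>m (q' \<oplus>\<^sub>m b') \<oplus>\<^sub>m t) ((p' \<oplus>\<^sub>m a') \<oplus>\<^sub>m (q \<oplus>\<^sub>m b) \<oplus>\<^sub>m t)"
    by (rule mvn_trans[OF _ _ mvn_trans[OF _ _ 1 2] 3])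
      (use P r(1) s(1) in \<open>auto simp: t_def intro!: dsum_projections\<close>)
  moreover have "t \<in> projections" using r(1) s(1) by (auto simp: t_def intro!: dsum_projections)
  ultimately show ?thesis using P by (auto simp: K0_rel_def dsum_projections)
qed

text \<open>\<open>K0_add\<close> is a union over all representatives; by \<open>K0_rel_dsum\<close>
  they all contribute the same class, so the union collapses to it.\<close>

lemma K0_add_diff:
  assumes "p \<in> projections" "q \<in> projections" "p' \<in> projections" "q' \<in> projections"
  shows "K0_add (K0_diff p q) (K0_diff p' q') = K0_diff (p \<oplus>\<^sub>m p') (q \<oplus>\<^sub>m q')"
proof -
  have self: "((a, b), (a, b)) \<in> K0_rel" if "a \<in> projections" "b \<in> projections" for a b :: "'a mat"
    using equiv_K0_rel that by (auto simp: equiv_def refl_on_def)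
  have same: "K0_diff (a \<oplus>\<^sub>m a') (b \<oplus>\<^sub>m b') = K0_diff (p \<oplus>\<^sub>m p') (q \<oplus>\<^sub>m q')"
    if "(a, b) \<in> K0_diff p q" "(a', b') \<in> K0_diff p' q'" for a b a' b'
  proof -
    have "((p, q), (a, b)) \<in> K0_rel" "((p', q'), (a', b')) \<in> K0_rel"
      using that unfolding K0_diff_def by blast+
    from K0_rel_dsum[OF this] show ?thesis
      unfolding K0_diff_def using equiv_class_eq[OF equiv_K0_rel] by blast
  qed
  have "(p, q) \<in> K0_diff p q" "(p', q') \<in> K0_diff p' q'"
    using self assms by (auto simp: K0_diff_def)
  then show ?thesis unfolding K0_add_def using same by (intro equalityI subsetI) blast+
qed

section \<open>Evaluation of \<open>K\<^sub>0\<close> classes at rational points\<close>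

abbreviation scalar_mat1 :: "'a \<Rightarrow> 'a mat" where
  "scalar_mat1 a \<equiv> mat 1 1 (\<lambda>_. a)"

lemma scalar_mat1_projection:
  assumes "is_projection p"
  shows "scalar_mat1 p \<in> projections"
proof -
  have "scalar_mat1 p * scalar_mat1 p = scalar_mat1 p"
    by (rule eq_matI) (use assms in \<open>auto simp: is_projection_def scalar_prod_def\<close>)
  moreover have "mat_star (scalar_mat1 p) = scalar_mat1 p"
    by (rule eq_matI) (use assms in \<open>auto simp: is_projection_def\<close>)
  ultimately show ?thesis by (simp add: projections_def)
qed

lemma mvn_scalar_mat1: "mvn_equiv (scalar_mat1 (star v * v)) (scalar_mat1 (v * star v))"
  unfolding mvn_equiv_def
proof (intro bexI conjI)
  show "scalar_mat1 (star v * v) = mat_star (scalar_mat1 v) * scalar_mat1 v"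
    by (rule eq_matI) (auto simp: scalar_prod_def)
  show "scalar_mat1 (v * star v) = scalar_mat1 v * mat_star (scalar_mat1 v)"
    by (rule eq_matI) (auto simp: scalar_prod_def)
qed simp

lemma mvn_orthogonal_sum:
  assumes "is_projection e" "is_projection f" "e * f = (0::'a::unital_cstar_algebra)"
  shows "mvn_equiv (scalar_mat1 (e + f)) (scalar_mat1 e \<oplus>\<^sub>m scalar_mat1 f)"
  unfolding mvn_equiv_def
proof (intro bexI conjI)
  have ef: "e * e = e" "f * f = f" "star e = e" "star f = f" "e * f = 0" "f * e = 0"
    using assms unfolding is_projection_def by (auto, metis star_mult star_zero)
  \<comment> \<open>The column with entries \<open>e\<close> and \<open>f\<close>; the off-diagonal
    entries of \<open>v * mat_star v\<close> are \<open>e * f\<close> and \<open>f * e\<close>,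
    which vanish.\<close>
  define v where "v = mat 2 1 (\<lambda>(i, j::nat). if i = 0 then e else f)"
  show "scalar_mat1 (e + f) = mat_star v * v"
    by (rule eq_matI) (auto simp: scalar_prod_def v_def ef numeral_2_eq_2)
  show "scalar_mat1 e \<oplus>\<^sub>m scalar_mat1 f = v * mat_star v"
    by (rule eq_matI) (auto simp: scalar_prod_def v_def ef dsum_def less_Suc_eq numeral_2_eq_2)
  show "v \<in> carrier_mat (dim_row (scalar_mat1 e \<oplus>\<^sub>m scalar_mat1 f)) (dim_row (scalar_mat1 (e + f)))"
    by (rule carrier_matI) (simp_all add: v_def)
qed

text \<open>On the piece \<open>c * x + d\<close> containing \<open>a / b\<close>, multiplication by
  \<open>b\<close> gives the integer \<open>c * a + d * b\<close>. Positive values at such a point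
  are therefore at least \<open>1 / b\<close>, which is what finally bounds the dimension of the
  representation.\<close>

lemma pw_integer_linear_rational:
  assumes f: "pw_integer_linear f" and b: "b > 0" and ab: "a \<le> b"
  shows "\<exists>z::int. real b * f (real a / real b) = of_int z"
proof -
  define x where "x = real a / real b"
  have x: "0 \<le> x" "x \<le> 1" using b ab by (auto simp: x_def)
  obtain k :: nat and t :: "nat \<Rightarrow> real" where t: "t 0 = 0" "t k = 1"
    and inc: "\<And>i. i < k \<Longrightarrow> t i < t (Suc i)"
    and lin: "\<And>i. i < k \<Longrightarrow> \<exists>a b :: int. \<forall>x\<in>{t i..t (Suc i)}. f x = of_int a * x + of_int b"
    using f unfolding pw_integer_linear_def by blast
  have "k > 0" using t by (cases k) auto
  have "\<exists>i<k. t i \<le> x \<and> x \<le> t (Suc i)"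
  proof -
    \<comment> \<open>The first breakpoint not left of \<open>x\<close>. The piece ending there
      contains \<open>x\<close>, except for \<open>j = 0\<close>, where \<open>x\<close> is the left
      endpoint and the first piece serves.\<close>
    define j where "j = (LEAST j. x \<le> t j)"
    have j: "x \<le> t j" unfolding j_def by (rule LeastI[of _ k]) (use x t in simp)
    have "j \<le> k" unfolding j_def by (rule Least_le) (use x t in simp)
    show ?thesis
    proof (cases j)
      case 0
      then have "x = t 0" using j x t by simp
      then show ?thesis using \<open>k > 0\<close> inc[of 0] by (intro exI[of _ 0]) auto
    next
      case (Suc i)
      then have "\<not> x \<le> t i" unfolding j_def by (metis lessI not_less_Least)
      then show ?thesis using Suc j \<open>j \<le> k\<close> by (intro exI[of _ i]) auto
    qed
  qed
  then obtain i where i: "i < k" "t i \<le> x" "x \<le> t (Suc i)" by blast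
  obtain c d :: int where "f x = of_int c * x + of_int d" using lin[OF i(1)] i(2,3) by force
  then have "real b * f x = of_int (c * int a + d * int b)"
    using b by (simp add: x_def field_simps)
  then show ?thesis unfolding x_def by blast
qed

lemma nonzero_at_rational:
  assumes f: "continuous_on {0..1} f" and x: "x \<in> {0..1}" "f x \<noteq> (0::real)"
  obtains a b :: nat where "b > 0" "a \<le> b" "f (real a / real b) \<noteq> 0"
proof -
  obtain d where d: "d > 0" "\<And>y. y \<in> {0..1} \<Longrightarrow> dist y x < d \<Longrightarrow> dist (f y) (f x) < \<bar>f x\<bar>"
    using f x unfolding continuous_on_iff by (metis zero_less_abs_iff)
  \<comment> \<open>A rational slightly to the right of \<open>x\<close> stays in the interval
    unless \<open>x = 1\<close>, and that point is itself rational.\<close>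
  have "\<exists>y\<in>\<rat>. y \<in> {0..1} \<and> dist y x < d"
  proof (cases "x < 1")
    case True
    then obtain y where "y \<in> \<rat>" "x < y" "y < min 1 (x + d)"
      using Rats_dense_in_real[of x "min 1 (x + d)"] d(1) by auto
    then show ?thesis using x by (intro bexI[of _ y]) (auto simp: dist_real_def)
  next
    case False
    then show ?thesis using x d(1) by (intro bexI[of _ 1]) auto
  qed
  then obtain y where y: "y \<in> \<rat>" "y \<in> {0..1}" "dist y x < d" by blast
  obtain a b :: nat where ab: "b \<noteq> 0" "\<bar>y\<bar> = real a / real b"
    using Rats_abs_nat_div_natE[OF y(1)] by metis
  have "f y \<noteq> 0" using d(2)[OF y(2,3)] by auto
  moreover have yab: "y = real a / real b" using ab(2) y(2) by simp
  moreover have "a \<le> b" using y(2) ab(1) by (auto simp: yab)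
  ultimately show ?thesis using that[of b a] ab(1) by simp
qed

section \<open>Values of projections under an isomorphism of ordered groups\<close>

context
  fixes \<phi> :: "('a::unital_cstar_algebra mat \<times> 'a mat) set \<Rightarrow> real \<Rightarrow> real"
  assumes iso: "\<phi> \<in> unital_po_group_iso (K0 TYPE('a)) M1"
begin

lemma K0_class_carrier: "P \<in> projections \<Longrightarrow> K0_class P \<in> carrier (K0 TYPE('a))"
  unfolding K0_def K0_diff_def by (auto intro: quotientI)

lemma iso_carrier: "P \<in> projections \<Longrightarrow> \<phi> (K0_class P) \<in> carrier M1"
  using iso K0_class_carrier unfolding unital_po_group_iso_def iso_def hom_def by auto

lemma iso_dsum:
  assumes "P \<in> projections" "Q \<in> projections" "x \<in> {0..1}"
  shows "\<phi> (K0_class (P \<oplus>\<^sub>m Q)) x = \<phi> (K0_class P) x + \<phi> (K0_class Q) x"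
proof -
  have "\<phi> (K0_class P \<otimes>\<^bsub>K0 TYPE('a)\<^esub> K0_class Q) = \<phi> (K0_class P) \<otimes>\<^bsub>M1\<^esub> \<phi> (K0_class Q)"
    using iso K0_class_carrier assms unfolding unital_po_group_iso_def iso_def hom_def by auto
  moreover have "K0_class P \<otimes>\<^bsub>K0 TYPE('a)\<^esub> K0_class Q = K0_class (P \<oplus>\<^sub>m Q)"
    using assms K0_add_diff[of P "0\<^sub>m 0 0" Q "0\<^sub>m 0 0"] by (simp add: K0_def)
  ultimately show ?thesis using assms(3) by (simp add: M1_def)
qed

lemma iso_zero: "x \<in> {0..1} \<Longrightarrow> \<phi> (K0_class (0\<^sub>m 0 0)) x = 0"
  using iso_dsum[of "0\<^sub>m 0 0" "0\<^sub>m 0 0" x] by simp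

lemma iso_nonneg:
  assumes P: "P \<in> projections" and x: "x \<in> {0..1}"
  shows "\<phi> (K0_class P) x \<ge> 0"
proof -
  have "K0_class P = K0_add (K0_class (0\<^sub>m 0 0)) (K0_class P)"
    using P K0_add_diff[of "0\<^sub>m 0 0" "0\<^sub>m 0 0" P "0\<^sub>m 0 0"] by simp
  then have "leq (K0 TYPE('a)) (K0_class (0\<^sub>m 0 0)) (K0_class P)"
    using P unfolding K0_def by auto
  then have "leq M1 (\<phi> (K0_class (0\<^sub>m 0 0))) (\<phi> (K0_class P))"
    using iso K0_class_carrier[OF P] K0_class_carrier[OF zero_projections]
    unfolding unital_po_group_iso_def by blast
  then have "\<phi> (K0_class (0\<^sub>m 0 0)) x \<le> \<phi> (K0_class P) x" using x by (simp add: M1_def)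
  then show ?thesis using iso_zero[OF x] by simp
qed

lemma K0_class_mvn:
  assumes "P \<in> projections" "Q \<in> projections" "mvn_equiv P Q"
  shows "K0_class P = K0_class Q"
  using assms by (subst K0_diff_eq_iff) (auto simp: K0_rel_def intro!: bexI[of _ "0\<^sub>m 0 0"])

text \<open>Injectivity of \<open>\<phi>\<close> turns the vanishing function into a vanishing
  class, and the summand \<open>R\<close> is the one hidden in the Grothendieck relation. Stable
  finiteness will rule this situation out for nonzero \<open>P\<close>.\<close>

lemma iso_eq_zero:
  assumes P: "P \<in> projections" and zero: "\<And>x. x \<in> {0..1} \<Longrightarrow> \<phi> (K0_class P) x = 0"
  obtains R where "R \<in> projections" "mvn_equiv (P \<oplus>\<^sub>m R) R"
proof -
  have Z: "0\<^sub>m 0 0 \<in> (projections :: 'a mat set)" by simp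
  have "\<phi> (K0_class P) = \<phi> (K0_class (0\<^sub>m 0 0))"
  proof (rule extensionalityI)
    show "\<phi> (K0_class P) \<in> extensional {0..1}" "\<phi> (K0_class (0\<^sub>m 0 0)) \<in> extensional {0..1}"
      using iso_carrier[OF P] iso_carrier[OF Z] by (auto simp: M1_def)
  qed (use zero iso_zero in auto)
  then have "K0_class P = K0_class (0\<^sub>m 0 0)"
    using iso K0_class_carrier[OF P] K0_class_carrier[OF Z]
    unfolding unital_po_group_iso_def iso_def bij_betw_def inj_on_def by auto
  then have "((P, 0\<^sub>m 0 0), (0\<^sub>m 0 0, 0\<^sub>m 0 0)) \<in> K0_rel"
    using K0_diff_eq_iff[OF P Z Z Z] by simp
  then show ?thesis using that unfolding K0_rel_def by auto
qed

text \<open>The function \<open>\<mu>\<close> of the outline, with the evaluation point as a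
  parameter.\<close>

definition projection_value :: "real \<Rightarrow> 'a \<Rightarrow> real" where
  "projection_value x p = \<phi> (K0_class (scalar_mat1 p)) x"

lemma projection_value_nonneg:
  "x \<in> {0..1} \<Longrightarrow> is_projection p \<Longrightarrow> projection_value x p \<ge> 0"
  unfolding projection_value_def by (intro iso_nonneg scalar_mat1_projection)

lemma projection_value_add:
  assumes x: "x \<in> {0..1}" and e: "is_projection e" and f: "is_projection f" and ef: "e * f = 0"
  shows "projection_value x (e + f) = projection_value x e + projection_value x f"
proof -
  have "f * e = 0" using e f ef unfolding is_projection_def by (metis star_mult star_zero)
  then have "is_projection (e + f)"
    using e f ef by (simp add: is_projection_def distrib_left distrib_right star_add)
  then have "K0_class (scalar_mat1 (e + f)) = K0_class (scalar_mat1 e \<oplus>\<^sub>m scalar_mat1 f)"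
    by (intro K0_class_mvn mvn_orthogonal_sum dsum_projections scalar_mat1_projection e f ef)
  then show ?thesis
    unfolding projection_value_def
    using iso_dsum[OF scalar_mat1_projection[OF e] scalar_mat1_projection[OF f] x] by simp
qed

lemma projection_value_mvn:
  assumes "is_projection (star v * v)" "is_projection (v * star v)"
  shows "projection_value x (star v * v) = projection_value x (v * star v)"
  unfolding projection_value_def
  using K0_class_mvn[OF scalar_mat1_projection[OF assms(1)] scalar_mat1_projection[OF assms(2)]
      mvn_scalar_mat1] by simp

lemma projection_value_one: "x \<in> {0..1} \<Longrightarrow> projection_value x 1 = 1"
proof -
  assume x: "x \<in> {0..1}"
  have "(scalar_mat1 1 :: 'a mat) = 1\<^sub>m 1" by (rule eq_matI) auto
  then have "projection_value x 1 = \<phi> (ounit (K0 TYPE('a))) x"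
    by (simp add: projection_value_def K0_def)
  also have "\<phi> (ounit (K0 TYPE('a))) = ounit M1"
    using iso by (simp add: unital_po_group_iso_def)
  finally show ?thesis using x by (simp add: M1_def)
qed

lemma projection_value_integral:
  assumes "is_projection p" "b > 0" "a \<le> b"
  shows "\<exists>z::int. real b * projection_value (real a / real b) p = of_int z"
  using iso_carrier[OF scalar_mat1_projection[OF assms(1)]] assms(2,3)
  unfolding projection_value_def M1_def by (intro pw_integer_linear_rational) auto

text \<open>By \<open>fin\<close> the class is nonzero, so its function is nonzero somewhere and, by
  continuity, at a rational point; positivity of \<open>\<phi>\<close> fixes the sign.\<close>

lemma projection_value_pos:
  assumes p: "is_projection p" and fin: "\<And>R. R \<in> projections \<Longrightarrow> \<not> mvn_equiv (scalar_mat1 p \<oplus>\<^sub>m R) R"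
  obtains a b :: nat where "b > 0" "a \<le> b" "projection_value (real a / real b) p > 0"
proof -
  note P = scalar_mat1_projection[OF p]
  obtain x where x: "x \<in> {0..1}" "\<phi> (K0_class (scalar_mat1 p)) x \<noteq> 0"
    using iso_eq_zero[OF P] fin by blast
  have "continuous_on {0..1} (\<phi> (K0_class (scalar_mat1 p)))"
    using iso_carrier[OF P] by (simp add: M1_def)
  then obtain a b :: nat where ab: "b > 0" "a \<le> b" "projection_value (real a / real b) p \<noteq> 0"
    unfolding projection_value_def using x by (rule nonzero_at_rational)
  moreover have "projection_value (real a / real b) p \<ge> 0"
    using ab by (intro projection_value_nonneg p) auto
  ultimately show ?thesis using that by force
qed

end

section \<open>Stable finiteness\<close>

text \<open>The image of a basis is independent and of the same size; a vector outside its span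
  would extend it beyond the dimension.\<close>

lemma (in vector_space) inj_on_fd_subspace_imp_surj:
  assumes V: "subspace V" and F: "finite F" "V \<subseteq> span F"
    and T: "Vector_Spaces.linear scale scale T" "T ` V \<subseteq> V" "inj_on T V"
  shows "T ` V = V"
proof
  interpret T: Vector_Spaces.linear scale scale T by (rule T(1))
  obtain B where B: "B \<subseteq> V" "independent B" "V \<subseteq> span B" "card B = dim V"
    by (rule basis_exists)
  have spanB: "span B = V" using B(1,3) span_minimal[OF _ V] by blast
  have finB: "finite B" using independent_span_bound[OF F(1) B(2)] B(1) F(2) by blast
  have indTB: "independent (T ` B)"
    by (rule T.independent_injective_image[OF B(2)]) (simp add: spanB T(3))
  have cardTB: "card (T ` B) = card B" by (meson B(1) T(3) card_image inj_on_subset)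
  show "V \<subseteq> T ` V"
  proof
    fix x assume x: "x \<in> V"
    have "x \<in> span (T ` B)"
    proof (rule ccontr)
      assume not: "x \<notin> span (T ` B)"
      then have "independent (insert x (T ` B))" using indTB by (rule independent_insertI)
      moreover have "insert x (T ` B) \<subseteq> span B" using x T(2) B(1) spanB by blast
      ultimately have "card (insert x (T ` B)) \<le> card B"
        using independent_span_bound[OF finB] by blast
      moreover have "x \<notin> T ` B" using not span_base[of x "T ` B"] by auto
      ultimately show False using finB cardTB by simp
    qed
    then show "x \<in> T ` V" unfolding T.span_image spanB .
  qed
qed (rule T(2))

text \<open>Left multiplication by \<open>w\<close> acts on the finite-dimensional space of columns
  over \<open>C\<close>. Being injective there, it is surjective, and preimages of the unit columns
  form a right inverse.\<close>

lemma fd_right_inverse: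
  fixes w :: "'a::unital_cstar_algebra mat"
  assumes C: "fd_unital_star_subalgebra C"
    and w: "w \<in> carrier_mat d d" "\<And>i j. i < d \<Longrightarrow> j < d \<Longrightarrow> w $$ (i, j) \<in> C"
    and inj: "\<And>x. x \<in> carrier_mat d d \<Longrightarrow> w * x = 0\<^sub>m d d \<Longrightarrow> x = 0\<^sub>m d d"
  obtains y where "y \<in> carrier_mat d d" "w * y = 1\<^sub>m d"
proof -
  \<comment> \<open>Columns are functions on the naturals that vanish from \<open>d\<close> on, with
    pointwise operations.\<close>
  interpret fs: vector_space "\<lambda>c (f :: nat \<Rightarrow> 'a) i. c *\<^sub>C f i"
    by standard (auto simp: fun_eq_iff scaleC_add_right scaleC_add_left scaleC_scaleC)
  have Csub: "complex_vector.subspace C" and C1: "1 \<in> C" and Cmult: "\<And>a b. a \<in> C \<Longrightarrow> b \<in> C \<Longrightarrow> a * b \<in> C"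
    using C by (auto simp: fd_unital_star_subalgebra_def)
  obtain S where S: "finite S" "C \<subseteq> complex_vector.span S"
    using C by (auto simp: fd_unital_star_subalgebra_def)
  define V where "V = {x :: nat \<Rightarrow> 'a. (\<forall>i<d. x i \<in> C) \<and> (\<forall>i\<ge>d. x i = 0)}"
  define T where "T x = (\<lambda>i. if i < d then \<Sum>k<d. w $$ (i, k) * x k else 0)" for x :: "nat \<Rightarrow> 'a"
  define single where "single a s = (\<lambda>i::nat. if i = a then s else 0)" for a and s :: 'a
  define F where "F = (\<lambda>(a, s). single a s) ` ({..<d} \<times> S)"
  have V: "fs.subspace V"
    unfolding fs.subspace_def V_def
    using Csub by (auto intro: complex_vector.subspace_0 complex_vector.subspace_add complex_vector.subspace_scale)
  have "finite F" using S(1) by (simp add: F_def)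
  have single: "single a s \<in> fs.span F" if a: "a < d" and s: "s \<in> complex_vector.span S" for a s
    using s
  proof (induction rule: complex_vector.span_induct_alt)
    case base
    have "single a 0 = 0" by (auto simp: single_def)
    show ?case unfolding \<open>single a 0 = 0\<close> by (rule fs.span_zero)
  next
    case (step c x y)
    have "single a (c *\<^sub>C x + y) = (\<lambda>i. c *\<^sub>C single a x i) + single a y"
      by (auto simp: single_def)
    moreover have "single a x \<in> fs.span F"
      using a step.hyps by (intro fs.span_base) (auto simp: F_def)
    ultimately show ?case using fs.span_add[OF fs.span_scale step.IH] by (simp only:)
  qed
  have VF: "V \<subseteq> fs.span F"
  proof
    fix x assume x: "x \<in> V"
    have "x = (\<Sum>a<d. single a (x a))"
    proof
      fix i
      have "(\<Sum>a<d. single a (x a)) i = (\<Sum>a<d. single a (x a) i)"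
        by (induction d) auto
      also have "\<dots> = x i" using x by (auto simp: single_def V_def)
      finally show "x i = (\<Sum>a<d. single a (x a)) i" ..
    qed
    moreover have "\<dots> \<in> fs.span F"
      using x S(2) by (intro fs.span_sum single) (auto simp: V_def)
    ultimately show "x \<in> fs.span F" by simp
  qed
  have lin: "Vector_Spaces.linear (\<lambda>c f i. c *\<^sub>C f i) (\<lambda>c f i. c *\<^sub>C f i) T"
    by (intro Vector_Spaces.linear_iff[THEN iffD2] conjI allI fs.vector_space_axioms)
      (auto simp: T_def fun_eq_iff distrib_left sum.distrib scaleC_mult_right complex_vector.scale_sum_right)
  have TV: "T ` V \<subseteq> V"
    unfolding T_def V_def using Csub Cmult w(2)
    by (auto intro!: complex_vector.subspace_sum)
  have Tinj: "x = 0" if x: "x \<in> V" "T x = 0" for x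
  proof
    fix i
    \<comment> \<open>The column \<open>x\<close> repeated \<open>d\<close> times, because
      \<open>inj\<close> speaks of square matrices.\<close>
    define X where "X = mat d d (\<lambda>(i, j). x i)"
    have "w * X = 0\<^sub>m d d"
    proof (rule eq_matI)
      fix i j assume ij: "i < dim_row (0\<^sub>m d d :: 'a mat)" "j < dim_col (0\<^sub>m d d :: 'a mat)"
      have "(w * X) $$ (i, j) = T x i"
        using ij w(1) by (simp add: X_def T_def scalar_prod_def atLeast0LessThan)
      then show "(w * X) $$ (i, j) = 0\<^sub>m d d $$ (i, j)" using ij x(2) by simp
    qed (use w(1) in \<open>auto simp: X_def\<close>)
    then have "X = 0\<^sub>m d d" using inj[of X] by (simp add: X_def)
    then have "X $$ (i, i) = 0" if "i < d" using that by simp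
    then show "x i = 0 i" using x(1) by (cases "i < d") (auto simp: X_def V_def)
  qed
  have "inj_on T V"
  proof (rule inj_onI)
    fix x y assume xy: "x \<in> V" "y \<in> V" "T x = T y"
    interpret T: Vector_Spaces.linear "\<lambda>c f i. c *\<^sub>C f i" "\<lambda>c f i. c *\<^sub>C f i" T by (rule lin)
    have "x - y = 0" using xy Tinj[of "x - y"] fs.subspace_diff[OF V] T.diff[of x y] by simp
    then show "x = y" by simp
  qed
  then have surj: "T ` V = V"
    by (rule fs.inj_on_fd_subspace_imp_surj[OF V \<open>finite F\<close> VF lin TV])
  have "\<exists>y. y \<in> V \<and> T y = single j 1" if "j < d" for j
  proof -
    have "single j 1 \<in> V" using that C1 complex_vector.subspace_0[OF Csub] by (auto simp: single_def V_def)
    then show ?thesis using surj by (metis imageE)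
  qed
  then obtain y where y: "\<And>j. j < d \<Longrightarrow> T (y j) = single j 1" by metis
  have "w * mat d d (\<lambda>(i, j). y j i) = 1\<^sub>m d"
  proof (rule eq_matI)
    fix i j assume ij: "i < dim_row (1\<^sub>m d :: 'a mat)" "j < dim_col (1\<^sub>m d :: 'a mat)"
    have "(w * mat d d (\<lambda>(i, j). y j i)) $$ (i, j) = T (y j) i"
      using ij w(1) by (simp add: T_def scalar_prod_def atLeast0LessThan)
    then show "(w * mat d d (\<lambda>(i, j). y j i)) $$ (i, j) = 1\<^sub>m d $$ (i, j)"
      using ij y by (simp add: single_def)
  qed (use w(1) in auto)
  then show ?thesis by (intro that) auto
qed

text \<open>The sum of the norms of the entries is submultiplicative, which suffices for the
  perturbation argument below; no C*-norm on matrices has to be constructed.\<close>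

definition entry_norm :: "'a::real_normed_algebra_1 mat \<Rightarrow> real" where
  "entry_norm A = (\<Sum>i<dim_row A. \<Sum>j<dim_col A. norm (A $$ (i, j)))"

lemma entry_norm_nonneg: "entry_norm A \<ge> 0"
  unfolding entry_norm_def by (intro sum_nonneg) auto

lemma entry_norm_zeroD:
  assumes "A \<in> carrier_mat n m" "entry_norm A \<le> 0"
  shows "A = 0\<^sub>m n m"
proof -
  have "entry_norm A = 0" using assms(2) entry_norm_nonneg[of A] by linarith
  then have "(\<Sum>j<m. norm (A $$ (i, j))) = 0" if "i < n" for i
    using that assms(1) unfolding entry_norm_def
    by (subst (asm) sum_nonneg_eq_0_iff) (auto intro!: sum_nonneg)
  then have "norm (A $$ (i, j)) = 0" if "i < n" "j < m" for i j
    using that by (subst (asm) sum_nonneg_eq_0_iff) auto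
  then show ?thesis using assms(1) by (intro eq_matI) auto
qed

lemma entry_norm_mult:
  assumes "dim_col A = dim_row B"
  shows "entry_norm (A * B) \<le> entry_norm A * entry_norm B"
proof -
  define n m l where "n = dim_row A" and "m = dim_col A" and "l = dim_col B"
  have "norm ((A * B) $$ (i, j)) \<le> (\<Sum>k<m. norm (A $$ (i, k)) * (\<Sum>k'<m. norm (B $$ (k', j))))"
    if "i < n" "j < l" for i j
  proof -
    have "(A * B) $$ (i, j) = (\<Sum>k<m. A $$ (i, k) * B $$ (k, j))"
      using that assms by (simp add: n_def m_def l_def scalar_prod_def atLeast0LessThan)
    also have "norm \<dots> \<le> (\<Sum>k<m. norm (A $$ (i, k)) * norm (B $$ (k, j)))"
      by (intro order_trans[OF norm_sum] sum_mono norm_mult_ineq)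
    \<comment> \<open>Enlarging each entry of \<open>B\<close> to its column sum uncouples the two
      factors, so that the total sum becomes a product.\<close>
    also have "\<dots> \<le> (\<Sum>k<m. norm (A $$ (i, k)) * (\<Sum>k'<m. norm (B $$ (k', j))))"
      by (intro sum_mono mult_left_mono member_le_sum) auto
    finally show ?thesis .
  qed
  then have "entry_norm (A * B) \<le> (\<Sum>i<n. \<Sum>j<l. \<Sum>k<m. norm (A $$ (i, k)) * (\<Sum>k'<m. norm (B $$ (k', j))))"
    unfolding entry_norm_def by (auto simp: n_def l_def intro!: sum_mono)
  also have "\<dots> = (\<Sum>i<n. \<Sum>k<m. norm (A $$ (i, k))) * (\<Sum>j<l. \<Sum>k'<m. norm (B $$ (k', j)))"
    by (simp only: sum_product sum_distrib_right[symmetric])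
  also have "\<dots> = entry_norm A * entry_norm B"
    unfolding entry_norm_def n_def m_def l_def assms by (subst (2) sum.swap) simp
  finally show ?thesis .
qed

lemma entry_norm_minus_le:
  assumes "A \<in> carrier_mat n m" "B \<in> carrier_mat n m"
  shows "entry_norm A \<le> entry_norm B + entry_norm (A - B)"
proof -
  have "norm (A $$ (i, j)) \<le> norm (B $$ (i, j)) + norm ((A - B) $$ (i, j))" if "i < n" "j < m" for i j
    using that assms norm_triangle_ineq[of "B $$ (i, j)" "A $$ (i, j) - B $$ (i, j)"] by auto
  then have "(\<Sum>i<n. \<Sum>j<m. norm (A $$ (i, j)))
      \<le> (\<Sum>i<n. \<Sum>j<m. norm (B $$ (i, j)) + norm ((A - B) $$ (i, j)))"
    by (intro sum_mono) auto
  moreover have "dim_row A = n" "dim_col A = m" "dim_row B = n" "dim_col B = m"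
    "dim_row (A - B) = n" "dim_col (A - B) = m"
    using assms by auto
  ultimately show ?thesis by (simp only: entry_norm_def sum.distrib)
qed

text \<open>In the finite-dimensional case a left-invertible \<open>u\<close> would also be right
  invertible. Here \<open>u\<close> is replaced by a nearby \<open>w\<close> over a single
  \<open>B N\<close>, which does have a right inverse \<open>y\<close>; with
  \<open>r = u - w\<close> the relation \<open>e * u = 0\<close> becomes
  \<open>e * r * y = - e\<close>, and smallness of \<open>r\<close> forces
  \<open>e = 0\<close>.\<close>

lemma AF_left_invertible_imp_epi:
  fixes u s e :: "'a::unital_cstar_algebra mat"
  assumes AF: "unital_AF_algebra TYPE('a)"
    and car: "u \<in> carrier_mat d d" "s \<in> carrier_mat d d" "e \<in> carrier_mat d d"
    and su: "s * u = 1\<^sub>m d" and eu: "e * u = 0\<^sub>m d d"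
  shows "e = 0\<^sub>m d d"
proof -
  obtain B :: "nat \<Rightarrow> 'a set" where B: "\<And>n. fd_unital_star_subalgebra (B n)"
    "\<And>n. B n \<subseteq> B (Suc n)" "closure (\<Union>n. B n) = UNIV"
    using AF unfolding unital_AF_algebra_def by blast
  have mono: "B n \<subseteq> B m" if "n \<le> m" for n m using B(2) that by (rule lift_Suc_mono_le)
  define \<sigma> where "\<sigma> = entry_norm s"
  have "\<sigma> \<ge> 0" by (simp add: \<sigma>_def entry_norm_nonneg)
  \<comment> \<open>Chosen so that the \<open>d * d\<close> entry errors sum to at most
    \<open>1 / (4 * (\<sigma> + 1))\<close>, hence
    \<open>\<sigma> * entry_norm r \<le> 1 / 4\<close>. The added ones keep the denominator positive
    when \<open>\<sigma>\<close> or \<open>d\<close> is zero.\<close>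
  define \<eta> where "\<eta> = 1 / (4 * (\<sigma> + 1) * (real d * real d + 1))"
  have "\<eta> > 0" using \<open>\<sigma> \<ge> 0\<close> by (auto simp: \<eta>_def intro!: divide_pos_pos mult_pos_pos add_nonneg_pos)
  have "\<exists>b. (\<exists>n. b \<in> B n) \<and> norm (u $$ (i, j) - b) < \<eta>" for i j
  proof -
    have "u $$ (i, j) \<in> closure (\<Union>n. B n)" using B(3) by simp
    then obtain b where "b \<in> (\<Union>n. B n)" "dist b (u $$ (i, j)) < \<eta>"
      using \<open>\<eta> > 0\<close> unfolding closure_approachable by blast
    then show ?thesis by (auto simp: dist_norm norm_minus_commute)
  qed
  then obtain b n where b: "\<And>i j. b i j \<in> B (n i j)" "\<And>i j. norm (u $$ (i, j) - b i j) < \<eta>" by metis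
  \<comment> \<open>The sum of all the indices serves as a common upper bound for them.\<close>
  define N where "N = (\<Sum>i<d. \<Sum>j<d. n i j)"
  have bN: "b i j \<in> B N" if "i < d" "j < d" for i j
  proof -
    have "n i j \<le> (\<Sum>j<d. n i j)" using that by (intro member_le_sum) auto
    also have "\<dots> \<le> N" unfolding N_def using that by (intro member_le_sum[of i _ "\<lambda>i. \<Sum>j<d. n i j"]) auto
    finally show ?thesis using b(1) mono by blast
  qed
  define w where "w = mat d d (\<lambda>(i, j). b i j)"
  have w: "w \<in> carrier_mat d d" by (simp add: w_def)
  define r where "r = u - w"
  have r: "r \<in> carrier_mat d d" unfolding r_def by (rule minus_carrier_mat[OF w])
  have dims: "dim_row r = d" "dim_col r = d" "dim_row s = d" "dim_col s = d"
    "dim_row e = d" "dim_col e = d" "dim_row u = d" "dim_col u = d" "dim_row w = d" "dim_col w = d"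
    using r car w by auto
  have "norm (r $$ (i, j)) \<le> \<eta>" if "i < d" "j < d" for i j
    using b(2)[of i j] that by (simp add: r_def w_def dims)
  then have "entry_norm r \<le> (\<Sum>i<d. \<Sum>j<d. \<eta>)"
    unfolding entry_norm_def dims by (intro sum_mono) auto
  also have "\<dots> = real d * real d * \<eta>" by simp
  also have "\<dots> \<le> (real d * real d + 1) * \<eta>" using \<open>\<eta> > 0\<close> by (intro mult_right_mono) auto
  also have "\<dots> = 1 / (4 * (\<sigma> + 1))"
    using add_nonneg_pos[of "real d * real d" 1] by (simp add: \<eta>_def)
  finally have nr: "entry_norm r \<le> 1 / (4 * (\<sigma> + 1))" .
  have \<sigma>r: "\<sigma> * entry_norm r \<le> 1 / 4"
  proof -
    have "\<sigma> * entry_norm r \<le> \<sigma> * (1 / (4 * (\<sigma> + 1)))" using nr \<open>\<sigma> \<ge> 0\<close> by (rule mult_left_mono)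
    also have "\<dots> \<le> 1 / 4" using \<open>\<sigma> \<ge> 0\<close> by (simp add: field_simps)
    finally show ?thesis .
  qed
  have nsr: "entry_norm (s * r) \<le> 1 / 4"
    using entry_norm_mult[of s r] \<sigma>r by (simp add: dims \<sigma>_def)
  have srx: "(z * r) * x = z * u * x - z * (w * x)"
    if "x \<in> carrier_mat d d" "z \<in> carrier_mat d d" for x z
  proof -
    have "(z * r) * x = (z * u - z * w) * x"
      unfolding r_def by (subst mult_minus_distrib_mat[OF that(2) car(1) w]) (rule refl)
    also have "\<dots> = z * u * x - z * w * x"
      by (rule minus_mult_distrib_mat[of _ d d]) (use that car w in auto)
    also have "z * w * x = z * (w * x)"
      using that by (intro mat_assoc) (auto simp: dims)
    finally show ?thesis .
  qed
  \<comment> \<open>If \<open>w * x = 0\<close> then \<open>(s * r) * x = s * u * x = x\<close>, so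
    \<open>x\<close> has at most a quarter of its own norm.\<close>
  have inj: "x = 0\<^sub>m d d" if x: "x \<in> carrier_mat d d" "w * x = 0\<^sub>m d d" for x
  proof -
    have "(s * r) * x = x - 0\<^sub>m d d"
      unfolding srx[OF x(1) car(2)] using x by (simp add: su right_mult_zero_mat[OF car(2)])
    also have "\<dots> = x" using x(1) by (intro eq_matI) auto
    finally have "entry_norm x \<le> entry_norm (s * r) * entry_norm x"
      using entry_norm_mult[of "s * r" x] x(1) by (simp add: dims)
    also have "\<dots> \<le> (1 / 4) * entry_norm x"
      by (intro mult_right_mono nsr entry_norm_nonneg)
    finally show ?thesis using entry_norm_nonneg[of x] by (intro entry_norm_zeroD x) auto
  qed
  obtain y where y: "y \<in> carrier_mat d d" "w * y = 1\<^sub>m d"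
    by (rule fd_right_inverse[OF B(1) w _ inj]) (use bN in \<open>auto simp: w_def\<close>)
  have ydims: "dim_row y = d" "dim_col y = d" using y(1) by auto
  \<comment> \<open>Bounds \<open>y\<close> independently of the approximation: its distance to
    \<open>s\<close> is at most a quarter of its own norm.\<close>
  have "(s * r) * y = y - s"
    unfolding srx[OF y(1) car(2)] by (simp add: su y(2) dims ydims)
  then have "entry_norm (y - s) \<le> entry_norm (s * r) * entry_norm y"
    using entry_norm_mult[of "s * r" y] by (simp add: dims ydims)
  also have "\<dots> \<le> (1 / 4) * entry_norm y"
    by (intro mult_right_mono nsr entry_norm_nonneg)
  finally have ny: "entry_norm y \<le> 2 * \<sigma>"
    using entry_norm_minus_le[OF y(1) car(2)] \<open>\<sigma> \<ge> 0\<close> unfolding \<sigma>_def by linarith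
  have "(e * r) * y = 0\<^sub>m d d - e"
    unfolding srx[OF y(1) car(3)] by (simp add: eu y(2) dims ydims)
  moreover have "entry_norm (0\<^sub>m d d - e) = entry_norm e" by (simp add: entry_norm_def dims)
  ultimately have "entry_norm e \<le> entry_norm (e * r) * entry_norm y"
    using entry_norm_mult[of "e * r" y] by (simp add: dims ydims)
  also have "\<dots> \<le> (entry_norm e * entry_norm r) * (2 * \<sigma>)"
    using entry_norm_mult[of e r] ny
    by (intro mult_mono entry_norm_nonneg mult_nonneg_nonneg) (auto simp: dims)
  also have "\<dots> = entry_norm e * (2 * (\<sigma> * entry_norm r))" by simp
  also have "\<dots> \<le> entry_norm e * (1 / 2)"
    using \<sigma>r by (intro mult_left_mono entry_norm_nonneg) auto
  finally show ?thesis using entry_norm_nonneg[of e] by (intro entry_norm_zeroD car) auto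
qed

text \<open>The hypothesis makes \<open>P = p \<oplus>\<^sub>m R\<close> equivalent to its
  subprojection \<open>Q\<close>, a padded copy of \<open>R\<close>. Completing the implementing
  matrix by \<open>1\<^sub>m d - P\<close> gives a left-invertible matrix annihilated from the left
  by \<open>e\<close>, the copy of \<open>p\<close> that is orthogonal to \<open>Q\<close>, so
  \<open>e\<close> vanishes.\<close>

lemma AF_stably_finite:
  fixes p R :: "'a::unital_cstar_algebra mat"
  assumes AF: "unital_AF_algebra TYPE('a)" and p: "p \<in> projections" and R: "R \<in> projections"
    and eq: "mvn_equiv (p \<oplus>\<^sub>m R) R"
  shows "p = 0\<^sub>m (dim_row p) (dim_row p)"
proof -
  define a b d where "a = dim_row p" and "b = dim_row R" and "d = a + b"
  \<comment> \<open>A zero block of the size of \<open>p\<close>, so that \<open>P\<close> and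
    \<open>Q\<close> have equal size and \<open>v\<close> is square.\<close>
  define Z where "Z = (0\<^sub>m a a :: 'a mat)"
  define P where "P = p \<oplus>\<^sub>m R"
  define Q where "Q = Z \<oplus>\<^sub>m R"
  define e where "e = p \<oplus>\<^sub>m (0\<^sub>m b b :: 'a mat)"
  have pc: "dim_row p = a" "dim_col p = a" "p * p = p" and Rc: "dim_row R = b" "dim_col R = b" "R * R = R"
    using projectionsD[OF p] projectionsD[OF R] by (simp_all only: a_def b_def)
  have P: "P \<in> projections" and Q: "Q \<in> projections"
    unfolding P_def Q_def Z_def using p R by (auto intro: dsum_projections)
  have car: "P \<in> carrier_mat d d" "Q \<in> carrier_mat d d" "e \<in> carrier_mat d d"
    by (auto simp: P_def Q_def e_def d_def pc Rc Z_def intro!: carrier_matI)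
  have "mvn_equiv (0\<^sub>m 0 0 :: 'a mat) Z"
    unfolding mvn_equiv_def Z_def by (intro bexI[of _ "0\<^sub>m a 0"]) (auto intro!: eq_matI simp: scalar_prod_def)
  then have "mvn_equiv (0\<^sub>m 0 0 \<oplus>\<^sub>m R) Q" unfolding Q_def by (intro dsum_mvn_cong mvn_refl R)
  then have "mvn_equiv R Q" by (simp only: dsum_zero)
  then have "mvn_equiv P Q" using eq unfolding P_def[symmetric] by (rule mvn_trans[OF P Q, rotated])
  then obtain v where v: "v \<in> carrier_mat d d" "P = mat_star v * v" "Q = v * mat_star v"
    unfolding mvn_equiv_def using car by auto
  have zero: "Z \<oplus>\<^sub>m 0\<^sub>m b b = (0\<^sub>m d d :: 'a mat)"
    by (rule eq_matI) (auto simp: Z_def d_def dsum_def)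
  have PQ: "P * Q = Q" "Q * P = Q" "e * P = e" "e * Q = 0\<^sub>m d d"
    using pc Rc zero by (simp_all add: P_def Q_def e_def dsum_mult Z_def)
  have PP: "P * P = P" "Q * Q = Q" using P Q by (simp_all add: projections_def)
  \<comment> \<open>Cutting \<open>v\<close> down on both sides gives \<open>P * x = x\<close> and
    \<open>y * P = y\<close>; these make the products with \<open>c\<close> vanish.\<close>
  define x where "x = Q * (v * P)"
  define y where "y = P * (mat_star v * Q)"
  have xy: "x \<in> carrier_mat d d" "y \<in> carrier_mat d d" using car v(1) by (auto simp: x_def y_def)
  have dims: "dim_row P = d" "dim_col P = d" "dim_row Q = d" "dim_col Q = d" "dim_row v = d" "dim_col v = d"
    "dim_row e = d" "dim_col e = d" "dim_row x = d" "dim_col x = d" "dim_row y = d" "dim_col y = d"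
    using car v(1) xy by auto
  have Px: "P * x = x" unfolding x_def by (simp add: mat_assoc[symmetric] dims PQ)
  have yP: "y * P = y" unfolding y_def by (simp add: mat_assoc dims PQ)
  have "y * x = P * (mat_star v * ((Q * Q) * (v * P)))"
    unfolding x_def y_def by (simp add: mat_assoc dims)
  also have "(Q * Q) * (v * P) = (v * mat_star v) * (v * P)" by (simp only: PP v(3)[symmetric])
  also have "mat_star v * ((v * mat_star v) * (v * P)) = (mat_star v * v) * ((mat_star v * v) * P)"
    by (simp add: mat_assoc dims)
  also have "\<dots> = P" by (simp only: v(2)[symmetric] PP)
  finally have yx: "y * x = P" by (simp only: PP)
  define c where "c = 1\<^sub>m d - P"
  have c: "c \<in> carrier_mat d d" unfolding c_def by (rule minus_carrier_mat[OF car(1)])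
  have yc: "y * c = 0\<^sub>m d d"
    unfolding c_def by (subst mult_minus_distrib_mat[of _ d d]) (use xy car yP in auto)
  have cx: "c * x = 0\<^sub>m d d"
    unfolding c_def by (subst minus_mult_distrib_mat[of _ d d]) (use xy car Px in auto)
  have Pc: "P * c = 0\<^sub>m d d"
    unfolding c_def by (subst mult_minus_distrib_mat[of _ d d]) (use car PP in auto)
  have cc: "c * c = c"
    by (subst (1) c_def, subst minus_mult_distrib_mat[of _ d d]) (use car c Pc in auto)
  have ec: "e * c = 0\<^sub>m d d"
    unfolding c_def by (subst mult_minus_distrib_mat[of _ d d]) (use car PQ in auto)
  have ex: "e * x = 0\<^sub>m d d"
    unfolding x_def using PQ(4) by (simp add: mat_assoc[symmetric] dims)
  have "(y + c) * (x + c) = (y + c) * x + (y + c) * c"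
    by (rule mult_add_distrib_mat[of _ d d]) (use xy c in auto)
  also have "(y + c) * x = P"
    by (subst add_mult_distrib_mat[of _ d d]) (use xy c cx yx car in auto)
  also have "(y + c) * c = c"
    by (subst add_mult_distrib_mat[of _ d d]) (use xy c cc yc in auto)
  also have "P + c = 1\<^sub>m d"
    unfolding c_def by (rule eq_matI) (use car in auto)
  finally have left_inv: "(y + c) * (x + c) = 1\<^sub>m d" .
  have "e * (x + c) = 0\<^sub>m d d"
    by (subst mult_add_distrib_mat[of _ d d]) (use xy c car ec ex in auto)
  then have "e = 0\<^sub>m d d"
    using AF_left_invertible_imp_epi[OF AF, of "x + c" d "y + c" e] left_inv xy c car by simp
  then have "e $$ (i, j) = 0" if "i < a" "j < a" for i j using that by (simp add: d_def)
  then show ?thesis unfolding a_def[symmetric]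
    by (intro eq_matI) (auto simp: e_def dsum_def pc)
qed

section \<open>Pure states with finite-dimensional GNS space\<close>

lemma index_mat_adjoint:
  "i < dim_col A \<Longrightarrow> j < dim_row A \<Longrightarrow> mat_adjoint A $$ (i, j) = conjugate (A $$ (j, i))"
  unfolding mat_adjoint_def by (simp add: mat_of_rows_index)

lemma dim_mat_adjoint: "dim_row (mat_adjoint A) = dim_col A" "dim_col (mat_adjoint A) = dim_row A"
  unfolding mat_adjoint_def by simp_all

text \<open>
  The representation is the GNS representation of \<open>\<omega>\<close>, in the orthonormal basis given by the
  classes of the \<open>d i\<close>; the hypothesis \<open>parseval\<close> says that these classes do span the GNS space.
\<close>

lemma fd_representation_GNS:
  fixes \<omega> :: "'a::unital_cstar_algebra \<Rightarrow> complex" and d :: "nat \<Rightarrow> 'a"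
  assumes add: "\<And>a b. \<omega> (a + b) = \<omega> a + \<omega> b" and scale: "\<And>c a. \<omega> (c *\<^sub>C a) = c * \<omega> a"
    and star: "\<And>a. \<omega> (star a) = cnj (\<omega> a)"
    and parseval: "\<And>a b. \<omega> (a * b) = (\<Sum>l<k. \<omega> (a * d l) * \<omega> (star (d l) * b))"
  defines "\<pi> \<equiv> \<lambda>a. mat k k (\<lambda>(i, j). \<omega> (star (d i) * a * d j))"
  shows "fd_representation k \<pi>" and "\<pi> a = 0\<^sub>m k k \<Longrightarrow> \<omega> (star a * a) = 0"
proof -
  have idx: "\<pi> a $$ (i, j) = \<omega> (star (d i) * a * d j)" if "i < k" "j < k" for a i j
    using that by (simp add: \<pi>_def)
  have dim: "dim_row (\<pi> a) = k" "dim_col (\<pi> a) = k" for a by (simp_all add: \<pi>_def)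
  show "fd_representation k \<pi>"
    unfolding fd_representation_def
  proof (intro conjI allI)
    fix a b :: 'a and c
    show "\<pi> a \<in> carrier_mat k k" by (rule carrier_matI) (simp_all add: dim)
    show "\<pi> (a + b) = \<pi> a + \<pi> b"
      by (rule eq_matI) (simp_all add: idx dim distrib_left distrib_right add)
    show "\<pi> (c *\<^sub>C a) = c \<cdot>\<^sub>m \<pi> a"
      by (rule eq_matI) (simp_all add: idx dim scaleC_mult_left scaleC_mult_right scale)
    show "\<pi> (a * b) = \<pi> a * \<pi> b"
    proof (rule eq_matI)
      fix i j assume "i < dim_row (\<pi> a * \<pi> b)" "j < dim_col (\<pi> a * \<pi> b)"
      then have ij: "i < k" "j < k" by (simp_all add: dim)
      have "\<pi> (a * b) $$ (i, j) = \<omega> ((star (d i) * a) * (b * d j))"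
        using ij by (simp add: idx mult.assoc)
      also have "\<dots> = (\<Sum>l<k. \<omega> (star (d i) * a * d l) * \<omega> (star (d l) * (b * d j)))"
        by (rule parseval)
      also have "\<dots> = (\<Sum>l<k. \<pi> a $$ (i, l) * \<pi> b $$ (l, j))"
        using ij by (intro sum.cong) (simp_all add: idx mult.assoc)
      also have "\<dots> = (\<pi> a * \<pi> b) $$ (i, j)"
        using ij by (simp add: dim scalar_prod_def atLeast0LessThan)
      finally show "\<pi> (a * b) $$ (i, j) = (\<pi> a * \<pi> b) $$ (i, j)" .
    qed (simp_all add: dim)
    show "\<pi> (star a) = mat_adjoint (\<pi> a)"
    proof (rule eq_matI)
      fix i j assume "i < dim_row (mat_adjoint (\<pi> a))" "j < dim_col (mat_adjoint (\<pi> a))"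
      then have ij: "i < k" "j < k" by (simp_all add: dim dim_mat_adjoint)
      have "star (d i) * star a * d j = star (star (d j) * a * d i)"
        by (simp add: star_mult star_star mult.assoc)
      then show "\<pi> (star a) $$ (i, j) = mat_adjoint (\<pi> a) $$ (i, j)"
        using ij by (simp add: idx index_mat_adjoint dim star conjugate_complex_def)
    qed (simp_all add: dim dim_mat_adjoint)
  qed
  show "\<omega> (star a * a) = 0" if "\<pi> a = 0\<^sub>m k k"
  proof -
    have zero: "\<omega> (star (d i) * a * d j) = 0" if "i < k" "j < k" for i j
      using idx[OF that, of a] that \<open>\<pi> a = 0\<^sub>m k k\<close> by simp
    \<comment> \<open>Here \<open>parseval\<close> is applied with second factor \<open>1\<close>:
      the vector of the unit is expanded in the basis, and every term contains a matrix entry of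
      \<open>\<pi> a\<close>.\<close>
    have "\<omega> (star (d l) * a) = 0" if "l < k" for l
      using parseval[of "star (d l) * a" 1] zero[OF that] by simp
    then show ?thesis using parseval[of "star a" a] by simp
  qed
qed

text \<open>
  Positivity of \<open>x\<^sup>* x\<close> in a corner without spectral theory: otherwise a suitable \<open>x' + s g\<close>
  with \<open>g x' = 0\<close> would be nonzero and satisfy \<open>y\<^sup>* y = 0\<close>.
\<close>

lemma minimal_corner_nonneg:
  fixes g x :: "'a::unital_cstar_algebra"
  assumes g: "is_projection g" "g \<noteq> 0" and x: "star x * x = z *\<^sub>C g" and gx: "g * x = l *\<^sub>C g"
  obtains t :: real where "t \<ge> 0" "z = of_real t"
proof -
  have gg: "g * g = g" "star g = g" using g by (auto simp: is_projection_def)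
  have "star (z *\<^sub>C g) = z *\<^sub>C g" unfolding x[symmetric] by (simp add: star_mult star_star)
  then have "cnj z = z" using g(2) by (simp add: star_scaleC gg)
  then have z: "z = of_real (Re z)" by (simp add: complex_eq_iff)
  \<comment> \<open>Subtracting the component along \<open>g\<close> makes
    \<open>g * x' = 0\<close>, so the cross terms drop out when a multiple of \<open>g\<close> is
    added back.\<close>
  define x' where "x' = x - l *\<^sub>C g"
  have sxg: "star x * g = cnj l *\<^sub>C g"
    by (metis gg(2) gx star_mult star_scaleC)
  have gx': "g * x' = 0" by (simp add: x'_def right_diff_distrib gx scaleC_mult_right gg)
  have x'g: "star x' * g = 0" by (metis gg(2) gx' star_mult star_zero)
  have "star x' * x = star x' * (x' + l *\<^sub>C g)" by (simp add: x'_def)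
  then have "star x' * x' = star x' * x" by (simp add: distrib_left scaleC_mult_right x'g)
  also have "\<dots> = (z - cnj l * l) *\<^sub>C g"
    by (simp add: x'_def star_diff star_scaleC gg left_diff_distrib x scaleC_mult_left gx scaleC_scaleC
        complex_vector.scale_left_diff_distrib)
  also have "z - cnj l * l = of_real (Re z - (cmod l)\<^sup>2)"
    by (subst z) (simp only: of_real_diff complex_norm_square mult.commute)
  finally have x'x': "star x' * x' = (Re z - (cmod l)\<^sup>2) *\<^sub>R g" by (simp only: scaleC_of_real)
  have "Re z - (cmod l)\<^sup>2 \<ge> 0"
  proof (rule ccontr)
    assume neg: "\<not> Re z - (cmod l)\<^sup>2 \<ge> 0"
    \<comment> \<open>The choice for which \<open>s * s\<close> cancels the negative coefficient.
      Then \<open>y = 0\<close>, although \<open>g * y\<close> is a nonzero multiple of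
      \<open>g\<close>.\<close>
    define s where "s = sqrt ((cmod l)\<^sup>2 - Re z)"
    have s: "s > 0" "s * s = (cmod l)\<^sup>2 - Re z" using neg by (auto simp: s_def)
    define y where "y = x' + s *\<^sub>R g"
    have "star y * y = (Re z - (cmod l)\<^sup>2) *\<^sub>R g + (s * s) *\<^sub>R g"
      by (simp add: y_def star_add star_scaleR gg distrib_left distrib_right x'x' gx' x'g)
    also have "\<dots> = 0" by (simp add: s(2) flip: scaleR_add_left)
    finally have "g * y = 0" by simp
    moreover have "g * y = s *\<^sub>R g" by (simp add: y_def distrib_left gx' gg)
    ultimately show False using s g(2) by simp
  qed
  then have "Re z \<ge> 0" using zero_le_power2[of "cmod l"] by linarith
  then show ?thesis using that z by blast
qed

text \<open>A decreasing sequence of minimal projections determines a pure state.\<close>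

locale minimal_projection_chain =
  fixes B :: "nat \<Rightarrow> 'a::unital_cstar_algebra set" and g :: "nat \<Rightarrow> 'a"
  assumes fd: "fd_unital_star_subalgebra (B n)" and B_Suc: "B n \<subseteq> B (Suc n)"
    and dense: "closure (\<Union>n. B n) = UNIV"
    and g_in: "g n \<in> B n" and g_proj: "is_projection (g n)" and g_nonzero: "g n \<noteq> 0"
    and g_Suc: "g n * g (Suc n) = g (Suc n)"
    and g_minimal: "b \<in> B n \<Longrightarrow> \<exists>c. g n * b * g n = c *\<^sub>C g n"
begin

section \<open>The decreasing projections and the dense union\<close>

lemma B_mono: "n \<le> m \<Longrightarrow> B n \<subseteq> B m"
  using B_Suc by (rule lift_Suc_mono_le)

lemma BD:
  "1 \<in> B n" "0 \<in> B n" "a \<in> B n \<Longrightarrow> b \<in> B n \<Longrightarrow> a + b \<in> B n" "a \<in> B n \<Longrightarrow> b \<in> B n \<Longrightarrow> a - b \<in> B n"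
  "a \<in> B n \<Longrightarrow> c *\<^sub>C a \<in> B n" "a \<in> B n \<Longrightarrow> b \<in> B n \<Longrightarrow> a * b \<in> B n" "a \<in> B n \<Longrightarrow> star a \<in> B n"
  using fd[of n] unfolding fd_unital_star_subalgebra_def
  by (auto intro: complex_vector.subspace_0 complex_vector.subspace_add
      complex_vector.subspace_diff complex_vector.subspace_scale)

lemma gg: "g n * g n = g n" "star (g n) = g n"
  using g_proj by (auto simp: is_projection_def)

lemma norm_g: "norm (g n) = 1"
  by (rule norm_projection[OF g_proj g_nonzero])

lemma g_decreasing:
  assumes "n \<le> m"
  shows "g n * g m = g m" "g m * g n = g m"
proof -
  show 1: "g n * g m = g m"
    using assms
  proof (induction rule: dec_induct)
    case (step k)
    then show ?case by (metis g_Suc mult.assoc)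
  qed (rule gg)
  then show "g m * g n = g m" by (metis gg(2) star_mult)
qed

definition D :: "'a set" where "D = (\<Union>n. B n)"

lemma B_sub_D: "B n \<subseteq> D" by (auto simp: D_def)

lemma D_common:
  assumes "a \<in> D" "b \<in> D"
  obtains n where "a \<in> B n" "b \<in> B n"
proof -
  obtain i j where ij: "a \<in> B i" "b \<in> B j" using assms by (auto simp: D_def)
  have "a \<in> B (max i j)" "b \<in> B (max i j)"
    using ij B_mono[of i "max i j"] B_mono[of j "max i j"] by auto
  then show ?thesis by (rule that)
qed

lemma DD:
  "a \<in> D \<Longrightarrow> b \<in> D \<Longrightarrow> a + b \<in> D" "a \<in> D \<Longrightarrow> b \<in> D \<Longrightarrow> a - b \<in> D" "a \<in> D \<Longrightarrow> c *\<^sub>C a \<in> D"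
  "0 \<in> D"
  using BD B_sub_D D_common by (metis subsetD, metis subsetD, metis subsetD, metis subsetD)

lemma D_seq: obtains b where "\<And>j. b j \<in> D" "b \<longlonglongrightarrow> a"
proof -
  have "a \<in> closure D" using dense by (simp add: D_def)
  then show ?thesis using that unfolding closure_sequential by blast
qed

section \<open>Construction of the state \<open>\<omega>\<close>\<close>

lemma compress_le: "norm (g m * a * g m) \<le> norm a"
proof -
  have "norm (g m * a * g m) \<le> norm (g m * a) * norm (g m)" by (rule norm_mult_ineq)
  also have "\<dots> \<le> norm (g m) * norm a" using norm_mult_ineq[of "g m" a] by (simp add: norm_g)
  finally show ?thesis by (simp add: norm_g)
qed

text \<open>For \<open>a\<close> in some \<open>B n\<close> the difference is zero from
  \<open>n\<close> on. The limit makes the notion meaningful on the whole algebra and stable under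
  norm limits.\<close>

definition has_value :: "'a \<Rightarrow> complex \<Rightarrow> bool" where
  "has_value a z \<longleftrightarrow> (\<lambda>m. g m * a * g m - z *\<^sub>C g m) \<longlonglongrightarrow> 0"

text \<open>Compression is contractive and each \<open>g m\<close> has norm one. Applied to
  differences, this yields uniqueness of the value and its continuity in \<open>a\<close>.\<close>

lemma has_value_le: "has_value a z \<Longrightarrow> cmod z \<le> norm a"
proof -
  assume "has_value a z"
  then have lim: "(\<lambda>m. norm (g m * a * g m - z *\<^sub>C g m) + norm a) \<longlonglongrightarrow> norm (0::'a) + norm a"
    unfolding has_value_def by (intro tendsto_intros)
  have "cmod z \<le> norm (g m * a * g m - z *\<^sub>C g m) + norm a" for m
  proof -
    have "cmod z = norm (z *\<^sub>C g m)" by (simp add: norm_scaleC norm_g)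
    also have "\<dots> = norm (g m * a * g m - (g m * a * g m - z *\<^sub>C g m))" by simp
    also have "\<dots> \<le> norm (g m * a * g m) + norm (g m * a * g m - z *\<^sub>C g m)" by (rule norm_triangle_ineq4)
    finally show ?thesis using compress_le[of m a] by linarith
  qed
  then show ?thesis using LIMSEQ_le_const[OF lim] by auto
qed

lemma has_value_add: "has_value a z \<Longrightarrow> has_value b w \<Longrightarrow> has_value (a + b) (z + w)"
  unfolding has_value_def
  by (drule (1) tendsto_add) (simp add: algebra_simps scaleC_add_left)

lemma has_value_scale:
  assumes "has_value a z"
  shows "has_value (c *\<^sub>C a) (c * z)"
proof -
  have "norm (g m * (c *\<^sub>C a) * g m - (c * z) *\<^sub>C g m) = cmod c * norm (g m * a * g m - z *\<^sub>C g m)" for m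
  proof -
    have "g m * (c *\<^sub>C a) * g m - (c * z) *\<^sub>C g m = c *\<^sub>C (g m * a * g m - z *\<^sub>C g m)"
      by (simp add: scaleC_mult_left scaleC_mult_right complex_vector.scale_right_diff_distrib scaleC_scaleC)
    then show ?thesis by (simp add: norm_scaleC)
  qed
  moreover have "(\<lambda>m. cmod c * norm (g m * a * g m - z *\<^sub>C g m)) \<longlonglongrightarrow> cmod c * norm (0::'a)"
    using assms unfolding has_value_def by (intro tendsto_intros)
  ultimately show ?thesis unfolding has_value_def by (subst tendsto_norm_zero_iff[symmetric]) simp
qed

lemma has_value_diff: "has_value a z \<Longrightarrow> has_value b w \<Longrightarrow> has_value (a - b) (z - w)"
  using has_value_add[of a z "- b" "- w"] has_value_scale[of b w "-1"]
  by simp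

lemma has_value_star:
  assumes "has_value a z"
  shows "has_value (star a) (cnj z)"
proof -
  have "g m * star a * g m - cnj z *\<^sub>C g m = star (g m * a * g m - z *\<^sub>C g m)" for m
    by (simp add: star_diff star_mult star_scaleC gg mult.assoc)
  then show ?thesis
    using bounded_linear.tendsto[OF bounded_linear_star, OF assms[unfolded has_value_def]]
    unfolding has_value_def by simp
qed

lemma has_value_unique: "has_value a z \<Longrightarrow> has_value a w \<Longrightarrow> z = w"
  using has_value_le[OF has_value_diff[of a z a w]] by simp

lemma has_value_B:
  assumes "b \<in> B n" "g n * b * g n = c *\<^sub>C g n"
  shows "has_value b c"
proof -
  have *: "g m * b * g m = c *\<^sub>C g m" if "n \<le> m" for m
  proof -
    have "g m * b * g m = g m * (g n * b * g n) * g m"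
      using g_decreasing[OF that] by (metis mult.assoc)
    also have "\<dots> = c *\<^sub>C (g m * g n * g m)" unfolding assms(2) by (simp add: scaleC_mult_left scaleC_mult_right)
    finally show ?thesis by (simp add: g_decreasing[OF that] gg)
  qed
  have "\<forall>\<^sub>F m in sequentially. g m * b * g m - c *\<^sub>C g m = 0"
    using eventually_ge_at_top[of n] by eventually_elim (simp add: *)
  then show ?thesis unfolding has_value_def by (rule tendsto_eventually)
qed

lemma has_value_D: "b \<in> D \<Longrightarrow> \<exists>c. has_value b c"
  using has_value_B g_minimal unfolding D_def by blast

text \<open>The values of approximants from \<open>D\<close> form a Cauchy sequence by
  \<open>has_value_le\<close>; a three-term estimate transfers their limit to
  \<open>a\<close>.\<close>

lemma has_value_exists: "\<exists>z. has_value a z"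
proof -
  obtain b where b: "\<And>j. b j \<in> D" "b \<longlonglongrightarrow> a" using D_seq[of a] by blast
  obtain c where c: "\<And>j. has_value (b j) (c j)" using has_value_D[OF b(1)] by metis
  have "Cauchy b" using b(2) by (rule LIMSEQ_imp_Cauchy)
  then have "Cauchy c"
    unfolding Cauchy_def dist_norm using has_value_le[OF has_value_diff[OF c c]]
    by (meson le_less_trans)
  then obtain z where z: "c \<longlonglongrightarrow> z" using Cauchy_convergent convergent_def by blast
  have "has_value a z"
    unfolding has_value_def
  proof (rule metric_LIMSEQ_I)
    fix e :: real assume e: "e > 0"
    have "\<forall>\<^sub>F j in sequentially. dist (b j) a < e / 3" "\<forall>\<^sub>F j in sequentially. dist (c j) z < e / 3"
      using tendstoD[OF b(2), of "e / 3"] tendstoD[OF z, of "e / 3"] e by auto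
    then have "\<forall>\<^sub>F j in sequentially. dist (b j) a < e / 3 \<and> dist (c j) z < e / 3"
      by (rule eventually_conj)
    then obtain j where j: "norm (a - b j) < e / 3" "cmod (c j - z) < e / 3"
      unfolding eventually_sequentially dist_norm by (metis norm_minus_commute order_refl)
    obtain M where M: "\<And>m. m \<ge> M \<Longrightarrow> norm (g m * b j * g m - c j *\<^sub>C g m) < e / 3"
      using metric_LIMSEQ_D[OF c[of j, unfolded has_value_def], of "e / 3"] e by (auto simp: dist_norm)
    have "norm (g m * a * g m - z *\<^sub>C g m) < e" if "m \<ge> M" for m
    proof -
      have "g m * a * g m - z *\<^sub>C g m = g m * (a - b j) * g m + (g m * b j * g m - c j *\<^sub>C g m) + (c j - z) *\<^sub>C g m"
        by (simp add: algebra_simps complex_vector.scale_left_diff_distrib)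
      also have "norm \<dots> \<le> norm (g m * (a - b j) * g m) + norm (g m * b j * g m - c j *\<^sub>C g m) + norm ((c j - z) *\<^sub>C g m)"
        by (intro norm_triangle_mono order_refl norm_triangle_ineq)
      also have "norm (g m * (a - b j) * g m) \<le> norm (a - b j)" by (rule compress_le)
      also have "norm ((c j - z) *\<^sub>C g m) = cmod (c j - z)" by (simp add: norm_scaleC norm_g)
      finally show ?thesis using j M[OF that] by linarith
    qed
    then show "\<exists>M. \<forall>m\<ge>M. dist (g m * a * g m - z *\<^sub>C g m) 0 < e" by (auto simp: dist_norm)
  qed
  then show ?thesis ..
qed

definition \<omega> :: "'a \<Rightarrow> complex" where "\<omega> a = (THE z. has_value a z)"

lemma has_value_iff: "has_value a z \<longleftrightarrow> \<omega> a = z"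
  unfolding \<omega>_def using has_value_exists has_value_unique by (metis the_equality)

lemma \<omega>_add: "\<omega> (a + b) = \<omega> a + \<omega> b"
  using has_value_add[of a _ b] by (simp add: has_value_iff)

lemma \<omega>_diff: "\<omega> (a - b) = \<omega> a - \<omega> b"
  using has_value_diff[of a _ b] by (simp add: has_value_iff)

lemma \<omega>_scale: "\<omega> (c *\<^sub>C a) = c * \<omega> a"
  using has_value_scale[of a] by (simp add: has_value_iff)

lemma \<omega>_star: "\<omega> (star a) = cnj (\<omega> a)"
  using has_value_star[of a] by (simp add: has_value_iff)

lemma \<omega>_le: "cmod (\<omega> a) \<le> norm a"
  using has_value_le[of a] by (simp add: has_value_iff)

lemma \<omega>_zero: "\<omega> 0 = 0"
  using \<omega>_diff[of 0 0] by simp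

lemma \<omega>_sum: "\<omega> (\<Sum>i\<in>I. f i) = (\<Sum>i\<in>I. \<omega> (f i))"
  by (induction I rule: infinite_finite_induct) (auto simp: \<omega>_add \<omega>_zero)

lemma bounded_linear_\<omega>: "bounded_linear \<omega>"
proof (rule bounded_linear_intro[of _ 1])
  show "\<omega> (r *\<^sub>R x) = r *\<^sub>R \<omega> x" for r x
    using \<omega>_scale[of "of_real r" x] by (simp only: scaleC_of_real scaleR_conv_of_real)
qed (use \<omega>_le in \<open>auto simp: \<omega>_add\<close>)

lemma \<omega>_B: "b \<in> B n \<Longrightarrow> g n * b * g n = \<omega> b *\<^sub>C g n"
  using g_minimal has_value_B has_value_iff by metis

lemma \<omega>_nonneg:
  assumes "b \<in> D"
  obtains t :: real where "t \<ge> 0" "\<omega> (star b * b) = of_real t"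
proof -
  obtain n where n: "b \<in> B n" using assms by (auto simp: D_def)
  show ?thesis
  proof (rule minimal_corner_nonneg[OF g_proj g_nonzero])
    show "star (b * g n) * (b * g n) = \<omega> (star b * b) *\<^sub>C g n"
      using \<omega>_B[of "star b * b" n] BD(6,7) n by (simp add: star_mult gg mult.assoc)
    show "g n * (b * g n) = \<omega> b *\<^sub>C g n"
      using \<omega>_B[OF n] by (simp add: mult.assoc)
  qed (rule that)
qed

text \<open>Takes the place of the Cauchy-Schwarz inequality: a null vector satisfies
  \<open>b * g m = 0\<close> for all large \<open>m\<close>, so every \<open>c * b\<close> is
  compressed to zero eventually.\<close>

lemma \<omega>_null:
  assumes "b \<in> D" "\<omega> (star b * b) = 0"
  shows "\<omega> (c * b) = 0"
proof -
  obtain n where n: "b \<in> B n" using assms by (auto simp: D_def)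
  have "g m * (c * b) * g m = 0" if "m \<ge> n" for m
  proof -
    have "b \<in> B m" using n B_mono[OF that] by blast
    then have "g m * (star b * b) * g m = 0"
      using \<omega>_B[of "star b * b" m] BD(6,7) assms(2) by simp
    then have "star (b * g m) * (b * g m) = 0" by (simp add: star_mult gg mult.assoc)
    then have "b * g m = 0" by simp
    then show ?thesis by (simp add: mult.assoc)
  qed
  then have "\<forall>\<^sub>F m in sequentially. g m * (c * b) * g m - 0 *\<^sub>C g m = 0"
    unfolding eventually_sequentially by auto
  then have "has_value (c * b) 0" unfolding has_value_def by (rule tendsto_eventually)
  then show ?thesis by (simp add: has_value_iff)
qed

text \<open>Orthonormality for the GNS form, the inner product of \<open>a\<close> and
  \<open>b\<close> being \<open>\<omega> (star a * b)\<close>. Representatives are taken in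
  \<open>D\<close> so that finitely many of them lie in one \<open>B n\<close>.\<close>

definition orthonormal :: "nat \<Rightarrow> (nat \<Rightarrow> 'a) \<Rightarrow> bool" where
  "orthonormal k d \<longleftrightarrow> (\<forall>i<k. d i \<in> D) \<and>
     (\<forall>i<k. \<forall>j<k. \<omega> (star (d i) * d j) = (if i = j then 1 else 0))"

text \<open>For \<open>b\<close> in \<open>D\<close>, the remainder after projection onto the system
  is orthogonal to it. If its length were positive, normalising it would enlarge the system; so it
  is a null vector and \<open>\<omega>_null\<close> removes it. Continuity of
  \<open>\<omega>\<close> extends the identity to all of the algebra.\<close>

lemma parseval:
  assumes orth: "orthonormal k d" and maximal: "\<And>d'. \<not> orthonormal (Suc k) d'"
  shows "\<omega> (c * a) = (\<Sum>l<k. \<omega> (c * d l) * \<omega> (star (d l) * a))"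
proof -
  have D: "\<omega> (c * b) = (\<Sum>l<k. \<omega> (c * d l) * \<omega> (star (d l) * b))" if b: "b \<in> D" for b
  proof -
    define s where "s = (\<Sum>l<k. \<omega> (star (d l) * b) *\<^sub>C d l)"
    define r where "r = b - s"
    have "s \<in> D"
      unfolding s_def using orth DD by (induction k) (auto simp: orthonormal_def)
    then have rD: "r \<in> D" using b DD(2) by (simp add: r_def)
    have cs: "\<omega> (x * s) = (\<Sum>l<k. \<omega> (x * d l) * \<omega> (star (d l) * b))" for x
      by (simp add: s_def sum_distrib_left scaleC_mult_right \<omega>_sum \<omega>_scale mult.commute)
    have dr: "\<omega> (star (d i) * r) = 0" if "i < k" for i
    proof -
      have "\<omega> (star (d i) * s) = (\<Sum>l<k. if i = l then \<omega> (star (d l) * b) else 0)"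
        unfolding cs using orth that by (intro sum.cong) (auto simp: orthonormal_def)
      also have "\<dots> = \<omega> (star (d i) * b)" using that by simp
      finally show ?thesis by (simp add: r_def right_diff_distrib \<omega>_diff)
    qed
    have rd: "\<omega> (star r * d i) = 0" if "i < k" for i
      using \<omega>_star[of "star (d i) * r"] dr[OF that] by (simp add: star_mult star_star)
    obtain t :: real where t: "t \<ge> 0" "\<omega> (star r * r) = of_real t" by (rule \<omega>_nonneg[OF rD])
    have "t = 0"
    proof (rule ccontr)
      assume "t \<noteq> 0"
      then have "t > 0" using t(1) by simp
      define u :: complex where "u = of_real (1 / sqrt t)"
      have "u * cnj u * of_real t = of_real (1 / sqrt t * (1 / sqrt t) * t)"
        by (simp only: u_def complex_cnj_complex_of_real of_real_mult)
      also have "\<dots> = 1" using \<open>t > 0\<close> by simp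
      finally have u: "u * cnj u * of_real t = 1" .
      define d' where "d' = d(k := u *\<^sub>C r)"
      have "orthonormal (Suc k) d'"
        unfolding orthonormal_def
      proof (intro conjI allI impI)
        show "d' i \<in> D" if "i < Suc k" for i
          using that orth rD DD(3) by (auto simp: d'_def orthonormal_def less_Suc_eq)
        show "\<omega> (star (d' i) * d' j) = (if i = j then 1 else 0)" if "i < Suc k" "j < Suc k" for i j
          using that orth dr rd u t(2)
          by (auto simp: d'_def orthonormal_def less_Suc_eq star_scaleC scaleC_mult_left scaleC_mult_right \<omega>_scale)
      qed
      then show False using maximal by blast
    qed
    then have "\<omega> (c * r) = 0" using \<omega>_null[OF rD] t(2) by simp
    then show ?thesis using cs[of c] by (simp add: r_def right_diff_distrib \<omega>_diff)
  qed
  obtain b where b: "\<And>j. b j \<in> D" "b \<longlonglongrightarrow> a" using D_seq[of a] by blast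
  have lim: "(\<lambda>j. \<omega> (x * b j)) \<longlonglongrightarrow> \<omega> (x * a)" for x
    by (intro bounded_linear.tendsto[OF bounded_linear_\<omega>] tendsto_intros b(2))
  have "(\<lambda>j. \<Sum>l<k. \<omega> (c * d l) * \<omega> (star (d l) * b j)) \<longlonglongrightarrow> (\<Sum>l<k. \<omega> (c * d l) * \<omega> (star (d l) * a))"
    by (intro tendsto_sum tendsto_mult tendsto_const lim)
  then have "(\<lambda>j. \<omega> (c * b j)) \<longlonglongrightarrow> (\<Sum>l<k. \<omega> (c * d l) * \<omega> (star (d l) * a))"
    using D[OF b(1)] by simp
  then show ?thesis using lim LIMSEQ_unique by blast
qed

text \<open>
  Orthonormal vectors \<open>d i\<close> give pairwise orthogonal projections \<open>d i g (d i)\<^sup>*\<close> equivalent to \<open>g\<close>,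
  so the values of \<open>\<mu>\<close> bound their number.
\<close>

lemma orthonormal_bound:
  fixes \<mu> :: "'a \<Rightarrow> real"
  assumes nonneg: "\<And>e. is_projection e \<Longrightarrow> \<mu> e \<ge> 0"
    and add: "\<And>e f. is_projection e \<Longrightarrow> is_projection f \<Longrightarrow> e * f = 0 \<Longrightarrow> \<mu> (e + f) = \<mu> e + \<mu> f"
    and mvn: "\<And>v. is_projection (star v * v) \<Longrightarrow> is_projection (v * star v) \<Longrightarrow> \<mu> (star v * v) = \<mu> (v * star v)"
    and one: "\<mu> 1 = 1" and lower: "\<And>n. \<mu> (g n) \<ge> \<epsilon>"
    and orth: "orthonormal k d"
  shows "real k * \<epsilon> \<le> 1"
proof -
  have "\<exists>n. \<forall>i<k. d i \<in> B n"
    using orth unfolding orthonormal_def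
  proof (induction k)
    case (Suc k)
    then obtain n where n: "\<forall>i<k. d i \<in> B n" by auto
    obtain n' where n': "d k \<in> B n'" using Suc.prems by (auto simp: D_def)
    have "\<forall>i<Suc k. d i \<in> B (max n n')"
      using n n' B_mono[of n "max n n'"] B_mono[of n' "max n n'"] by (auto simp: less_Suc_eq)
    then show ?case ..
  qed simp
  then obtain n where n: "\<And>i. i < k \<Longrightarrow> d i \<in> B n" by blast
  \<comment> \<open>The \<open>v i\<close> are partial isometries with common source
    \<open>g n\<close>, and their ranges \<open>e i\<close> are orthogonal because the
    \<open>d i\<close> are.\<close>
  define v where "v i = d i * g n" for i
  define e where "e i = v i * star (v i)" for i
  have vv: "star (v i) * v j = (if i = j then g n else 0)" if "i < k" "j < k" for i j
  proof -
    have "star (v i) * v j = g n * (star (d i) * d j) * g n" by (simp add: v_def star_mult gg mult.assoc)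
    also have "\<dots> = \<omega> (star (d i) * d j) *\<^sub>C g n" using n that BD by (intro \<omega>_B) auto
    finally show ?thesis using orth that by (simp add: orthonormal_def)
  qed
  have vg: "v i * g n = v i" for i by (simp add: v_def mult.assoc gg)
  have ee: "e i * e j = (if i = j then e i else 0)" if "i < k" "j < k" for i j
  proof -
    have "e i * e j = v i * (star (v i) * v j) * star (v j)" by (simp add: e_def mult.assoc)
    then show ?thesis using vv[OF that] by (simp add: vg e_def)
  qed
  have e_proj: "is_projection (e i)" if "i < k" for i
    using ee[OF that that] by (simp add: is_projection_def) (simp add: e_def star_mult star_star)
  have \<mu>e: "\<mu> (e i) = \<mu> (g n)" if "i < k" for i
    using mvn[of "v i"] vv[OF that that] e_proj[OF that] g_proj by (simp add: e_def)
  have "is_projection (\<Sum>i<j. e i) \<and> \<mu> (\<Sum>i<j. e i) = real j * \<mu> (g n)" if "j \<le> k" for j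
    using that
  proof (induction j)
    case 0
    have "\<mu> (0 + 0) = \<mu> 0 + \<mu> 0" by (rule add) (auto simp: is_projection_def)
    then show ?case by (simp add: is_projection_def)
  next
    case (Suc j)
    define s where "s = (\<Sum>i<j. e i)"
    have s: "is_projection s" "\<mu> s = real j * \<mu> (g n)" using Suc by (auto simp: s_def)
    have "s * e j = (\<Sum>i<j. e i * e j)" by (simp add: s_def sum_distrib_right)
    also have "\<dots> = 0" using Suc.prems ee by (intro sum.neutral) auto
    finally have se: "s * e j = 0" .
    have p: "is_projection (e j)" using Suc.prems e_proj by simp
    have "e j * s = 0" using se s(1) p unfolding is_projection_def by (metis star_mult star_zero)
    then have "is_projection (s + e j)"
      using se s(1) p by (simp add: is_projection_def distrib_left distrib_right star_add)
    moreover have "\<mu> (s + e j) = real (Suc j) * \<mu> (g n)"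
      using add[OF s(1) p se] s(2) \<mu>e[of j] Suc.prems by (simp add: algebra_simps)
    ultimately show ?case by (simp add: s_def)
  qed
  from this[of k] obtain s where s: "is_projection s" "\<mu> s = real k * \<mu> (g n)" by blast
  \<comment> \<open>The complement of the sum has nonnegative value, so the sum has value at most
    that of \<open>1\<close>.\<close>
  have "is_projection (1 - s)" "s * (1 - s) = 0"
    using s(1) by (auto simp: is_projection_def left_diff_distrib right_diff_distrib star_diff)
  then have "\<mu> s \<le> 1" using add[OF s(1), of "1 - s"] nonneg[of "1 - s"] one by simp
  moreover have "real k * \<epsilon> \<le> real k * \<mu> (g n)" using lower by (intro mult_left_mono) auto
  ultimately show ?thesis using s(2) by linarith
qed

lemma exists_fd_representation:
  assumes bound: "\<And>k d. orthonormal k d \<Longrightarrow> k \<le> N" and a: "\<omega> (star a * a) \<noteq> 0"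
  shows "\<exists>k \<pi>. fd_representation k \<pi> \<and> \<pi> a \<noteq> 0\<^sub>m k k"
proof -
  have "\<exists>d. orthonormal 0 d" by (simp add: orthonormal_def)
  then obtain k where "\<exists>d. orthonormal k d" and max: "\<And>k' d'. orthonormal k' d' \<Longrightarrow> k' \<le> k"
    using ex_has_greatest_nat[of "\<lambda>k. \<exists>d. orthonormal k d" 0 id "Suc N"] bound
    by (metis id_apply le_imp_less_Suc)
  then obtain d where d: "orthonormal k d" by blast
  have "\<not> orthonormal (Suc k) d'" for d' using max[of "Suc k" d'] by auto
  note P = parseval[OF d this]
  show ?thesis
    using fd_representation_GNS[where \<omega> = \<omega> and k = k and d = d, OF \<omega>_add \<omega>_scale \<omega>_star P] a by blast
qed

end

section \<open>Residual finite-dimensionality\<close>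

lemma fd_unital_imp_fd_star_subalgebra:
  "fd_unital_star_subalgebra B \<Longrightarrow> fd_star_subalgebra B"
  unfolding fd_unital_star_subalgebra_def fd_star_subalgebra_def by auto

lemma AF_projection_value_pos:
  fixes p :: "'a::unital_cstar_algebra"
  assumes AF: "unital_AF_algebra TYPE('a)" and iso: "\<phi> \<in> unital_po_group_iso (K0 TYPE('a)) M1"
    and p: "is_projection p" "p \<noteq> 0"
  obtains a b :: nat where "b > 0" "a \<le> b" "projection_value \<phi> (real a / real b) p > 0"
proof (rule projection_value_pos[OF iso p(1)])
  show "\<not> mvn_equiv (scalar_mat1 p \<oplus>\<^sub>m R) R" if R: "R \<in> projections" for R
  proof
    assume "mvn_equiv (scalar_mat1 p \<oplus>\<^sub>m R) R"
    from AF_stably_finite[OF AF scalar_mat1_projection[OF p(1)] R this]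
    have "scalar_mat1 p $$ (0, 0) = 0\<^sub>m 1 1 $$ (0, 0)" by simp
    then show False using p(2) by simp
  qed
qed (rule that)

text \<open>The values at \<open>k / l\<close> are multiples of \<open>1 / l\<close>, so the
  positive ones along the chain stay at least \<open>1 / l\<close>; hence no orthonormal system has
  more than \<open>l\<close> members.\<close>

lemma fd_representation_from_chain:
  fixes a :: "'a::unital_cstar_algebra"
  assumes chain: "minimal_projection_chain B g" and iso: "\<phi> \<in> unital_po_group_iso (K0 TYPE('a)) M1"
    and kl: "l > 0" "k \<le> l" and pos: "\<And>n. projection_value \<phi> (real k / real l) (g n) > 0"
    and a: "minimal_projection_chain.\<omega> g (star a * a) \<noteq> 0"
  shows "\<exists>n \<pi>. fd_representation n \<pi> \<and> \<pi> a \<noteq> 0\<^sub>m n n"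
proof -
  interpret minimal_projection_chain B g by (rule chain)
  define x where "x = real k / real l"
  have x: "x \<in> {0..1}" using kl by (auto simp: x_def)
  have lower: "projection_value \<phi> x (g n) \<ge> 1 / real l" for n
  proof -
    obtain z :: int where z: "real l * projection_value \<phi> x (g n) = of_int z"
      using projection_value_integral[OF iso g_proj kl] unfolding x_def by blast
    have "real l * projection_value \<phi> x (g n) > 0" using pos kl(1) by (simp add: x_def)
    then have "1 \<le> z" unfolding z by simp
    then have "1 \<le> real l * projection_value \<phi> x (g n)" unfolding z by simp
    then show ?thesis using kl(1) by (simp add: field_simps)
  qed
  have "n \<le> l" if "orthonormal n d" for n d
  proof -
    have "real n * (1 / real l) \<le> 1"
    proof (rule orthonormal_bound[where \<mu> = "projection_value \<phi> x"])
      show "orthonormal n d" by (rule that)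
    qed (use projection_value_nonneg[OF iso x] projection_value_add[OF iso x] projection_value_mvn[OF iso]
        projection_value_one[OF iso x] lower in blast)+
    then show ?thesis using kl(1) by (simp add: field_simps)
  qed
  then show ?thesis using exists_fd_representation a by blast
qed

text \<open>The strict inequality is what keeps \<open>\<omega> (star a * a)\<close> away from zero
  once \<open>\<omega> (star b * b)\<close> has modulus \<open>(norm b)\<^sup>2\<close>. It holds
  far along any approximating sequence, because the two sides tend to \<open>0\<close> and to
  \<open>(norm a)\<^sup>2\<close>.\<close>

lemma AF_approximation:
  fixes a :: "'a::unital_cstar_algebra"
  assumes dense: "closure D = UNIV" and a: "a \<noteq> 0"
  obtains b where "b \<in> D" "norm (star a * a - star b * b) < (norm b)\<^sup>2"
proof -
  have "a \<in> closure D" using dense by simp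
  then obtain b where b: "\<And>j. b j \<in> D" "b \<longlonglongrightarrow> a" unfolding closure_sequential by blast
  have sb: "(\<lambda>j. star (b j)) \<longlonglongrightarrow> star a" by (rule bounded_linear.tendsto[OF bounded_linear_star b(2)])
  have "(\<lambda>j. (norm (b j))\<^sup>2 - norm (star a * a - star (b j) * b j)) \<longlonglongrightarrow>
      (norm a)\<^sup>2 - norm (star a * a - star a * a)"
    by (intro tendsto_intros b(2) sb)
  moreover have "(norm a)\<^sup>2 - norm (star a * a - star a * a) > 0" using a by simp
  ultimately have "\<forall>\<^sub>F j in sequentially. (norm (b j))\<^sup>2 - norm (star a * a - star (b j) * b j) > 0"
    by (rule order_tendstoD)
  then obtain j where "(norm (b j))\<^sup>2 - norm (star a * a - star (b j) * b j) > 0"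
    unfolding eventually_sequentially by blast
  then show ?thesis using that[of "b j"] b(1) by simp
qed

theorem theorem7p3:
  assumes "Farey_Stern_Brocot_AF TYPE('a::unital_cstar_algebra)"
  shows "residually_finite_dimensional TYPE('a)"
  unfolding residually_finite_dimensional_def
proof (intro allI impI)
  fix a :: 'a assume a: "a \<noteq> 0"
  have AF: "unital_AF_algebra TYPE('a)" using assms by (simp add: Farey_Stern_Brocot_AF_def)
  obtain \<phi> where iso: "\<phi> \<in> unital_po_group_iso (K0 TYPE('a)) M1"
    using assms by (auto simp: Farey_Stern_Brocot_AF_def)
  obtain B :: "nat \<Rightarrow> 'a set" where B: "\<And>n. fd_unital_star_subalgebra (B n)"
    "\<And>n. B n \<subseteq> B (Suc n)" "closure (\<Union>n. B n) = UNIV"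
    using AF unfolding unital_AF_algebra_def by blast
  have mono: "B n \<subseteq> B m" if "n \<le> m" for n m using B(2) that by (rule lift_Suc_mono_le)
  note fd = fd_unital_imp_fd_star_subalgebra[OF B(1)]
  obtain b where "b \<in> (\<Union>n. B n)" and ab: "norm (star a * a - star b * b) < (norm b)\<^sup>2"
    using AF_approximation[OF B(3) a] by blast
  then obtain N where b: "b \<in> B N" by blast
  define h where "h = star b * b"
  have h: "h \<in> B N" "star h = h"
    using b fd_star_subalgebraD[OF fd] by (auto simp: h_def star_mult star_star)
  have normh: "norm h = (norm b)\<^sup>2" by (simp add: h_def cstar_identity)
  have "h \<noteq> 0" using ab normh by (metis norm_ge_zero norm_zero not_less)
  then obtain r :: real and p where p: "p \<in> B N" "is_projection p" "p \<noteq> 0" "h * p = r *\<^sub>R p" "\<bar>r\<bar> = norm h"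
    by (rule exists_norm_eigenprojection[OF fd h(1) _ h(2)])
  obtain k l :: nat where kl: "l > 0" "k \<le> l" and pos: "projection_value \<phi> (real k / real l) p > 0"
    by (rule AF_projection_value_pos[OF AF iso p(2,3)])
  define \<mu> where "\<mu> = projection_value \<phi> (real k / real l)"
  have x: "real k / real l \<in> {0..1}" using kl by auto
  have add: "\<mu> (e + f) = \<mu> e + \<mu> f" if "is_projection e" "is_projection f" "e * f = 0" for e f
    unfolding \<mu>_def using projection_value_add[OF iso x that] .
  define good where "good n g \<longleftrightarrow> g \<in> B (N + n) \<and> is_projection g \<and> \<mu> g > 0 \<and>
    (\<forall>b\<in>B (N + n). \<exists>c. g * b * g = c *\<^sub>C g)" for n g
  have step: "\<exists>g. good n g \<and> f * g = g" if f: "f \<in> B (N + n)" "is_projection f" "\<mu> f > 0" for n f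
  proof -
    obtain g where "g \<in> B (N + n)" "is_projection g" "f * g = g" "\<mu> g > 0"
      "\<And>b. b \<in> B (N + n) \<Longrightarrow> \<exists>c. g * b * g = c *\<^sub>C g"
      by (rule exists_minimal_projection[of "B (N + n)" \<mu> f]) (use fd add f in blast)+
    then show ?thesis unfolding good_def by blast
  qed
  \<comment> \<open>Minimality in \<open>B (N + n)\<close> may be lost in the next algebra, but the
    positive value persists and allows a new choice below the old projection. The clause for
    \<open>n = 0\<close> starts the chain below \<open>p\<close>.\<close>
  have "\<exists>g. \<forall>n. (good n (g n) \<and> (n = 0 \<longrightarrow> p * g n = g n)) \<and> g n * g (Suc n) = g (Suc n)"
  proof (rule dependent_nat_choice)
    show "\<exists>g. good 0 g \<and> (0 = (0::nat) \<longrightarrow> p * g = g)"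
      using step[of p 0] p(1,2) pos by (auto simp: \<mu>_def)
    show "\<exists>g. (good (Suc n) g \<and> (Suc n = 0 \<longrightarrow> p * g = g)) \<and> f * g = g"
      if "good n f \<and> (n = 0 \<longrightarrow> p * f = f)" for f n
      using step[of f "Suc n"] that mono[of "N + n" "N + Suc n"] by (auto simp: good_def)
  qed
  then obtain g where good: "\<And>n. good n (g n)" and pg: "p * g 0 = g 0"
    and g_Suc: "\<And>n. g n * g (Suc n) = g (Suc n)" by blast
  have \<mu>0: "\<mu> 0 = 0" using add[of 0 0] by (simp add: is_projection_def)
  have chain: "minimal_projection_chain (\<lambda>n. B (N + n)) g"
  proof
    have "(\<Union>n. B n) \<subseteq> (\<Union>n. B (N + n))" using mono by (meson SUP_mono' le_add2)
    then show "closure (\<Union>n. B (N + n)) = UNIV" using B(3) closure_mono by blast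
    show "g n \<noteq> 0" for n using good[of n] \<mu>0 by (auto simp: good_def)
  qed (use B(1) B(2) good g_Suc in \<open>auto simp: good_def\<close>)
  interpret minimal_projection_chain "\<lambda>n. B (N + n)" g by (rule chain)
  \<comment> \<open>Below the eigenprojection \<open>p\<close> the element \<open>h\<close> acts as
    the scalar \<open>r\<close>, so \<open>\<omega> h = r\<close>, whose modulus is
    \<open>norm h\<close>.\<close>
  have "h * g 0 = r *\<^sub>R g 0"
    by (metis mult.assoc mult_scaleR_left p(4) pg)
  then have "g 0 * h * g 0 = r *\<^sub>R g 0" by (simp add: mult.assoc gg)
  then have "\<omega> h *\<^sub>C g 0 = complex_of_real r *\<^sub>C g 0"
    using \<omega>_B[of h 0] h(1) by (simp add: scaleC_of_real)
  then have "\<omega> h = complex_of_real r" using g_nonzero by simp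
  then have "cmod (\<omega> h) = (norm b)\<^sup>2" using p(5) normh by simp
  \<comment> \<open>Since \<open>\<omega>\<close> is contractive,
    \<open>\<omega> (star a * a)\<close> is closer to \<open>\<omega> h\<close> than
    \<open>\<omega> h\<close> is to zero.\<close>
  moreover have "cmod (\<omega> (star a * a) - \<omega> h) < (norm b)\<^sup>2"
    using \<omega>_le[of "star a * a - h"] ab unfolding h_def \<omega>_diff by linarith
  ultimately have "\<omega> (star a * a) \<noteq> 0" by auto
  moreover have "projection_value \<phi> (real k / real l) (g n) > 0" for n
    using good[of n] by (simp add: good_def \<mu>_def)
  ultimately show "\<exists>n \<pi>. fd_representation n \<pi> \<and> \<pi> a \<noteq> 0\<^sub>m n n"
    by (intro fd_representation_from_chain[OF chain iso kl])
qed

end
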